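(* Let $\nu$ be an arbitrary probability measure on $\mathbb{R}$ with characteristic function $\phi(\xi)=\int_{\mathbb{R}}e^{i\xi x}\,\nu(\mathrm{d}x)$, and let $(N,C,A_1,A_2,\ldots)$ be a random vector with values in $\{0,1,2,\ldots\}\times\mathbb{R}\times(0,\infty)^{\mathbb{N}}$. Assume that (i) $\int_{1-\varepsilon}^1 \frac{\mathrm{d}s}{s-\mathbb{E}[s^N]}=\infty$ for all sufficiently small $\varepsilon>0$; (ii) $\mathbb{P}[A_1>0,\ldots,A_m>0\mid N=m]=1$ for every $m\in\mathbb{N}$; (iii) for some $m$ with $\mathbb{P}[N=m]>0$ one has $\mathbb{P}[A_1=1,\ldots,A_m=1\mid N=m]<1$; (iv) $\mathbb{E}[N]\in(1,\infty]$. Consider the Cauchy problem $$\partial_t\phi_t(\xi)=\widehat{\mathcal{Q}}\phi_t(\xi)-\phi_t(\xi),\qquad \phi_0(\xi)=\phi(\xi),\qquad t\ge 0,\ \xi\in\mathbb{R},$$ where $\widehat{\mathcal{Q}}\psi(\xi)=\mathbb{E}\big[e^{i\xi C}\prod_{k=1}^N\psi(A_k\xi)\big]$ for continuous $\psi:\mathbb{R}\to\{z\in\mathbb{C}:|z|\le 1\}$. Then, in the class of functions $(t,\xi)\mapsto\phi_t(\xi)$ from $[0,\infty)\times\mathbb{R}$ to $\mathbb{C}$ such that $\phi_t(\cdot)$ is the characteristic function of a probability measure on $\mathbb{R}$ for every $t\ge0$ and $t\mapsto\phi_t(\xi)$ is continuously differentiable on $[0,\infty)$ for every $\xi\in\mathbb{R}$,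 this problem has a unique solution, and it is given by $$\phi_t(\xi)=\mathbb{E}\exp\{i\xi W_t\},\qquad W_t=\sum_{x\in\partial\mathcal{T}_t}e^{V(x)}R(x)+\sum_{x\in\mathcal{T}_t^o}e^{V(x)}C(x),$$ where the random sets $\partial\mathcal{T}_t,\mathcal{T}_t^o$ and the variables $V(x),R(x),C(x)$ are those of the marked continuous-time branching random walk defined in the context.
   Context: Marked continuous-time branching random walk. Let $E$ be a unit mean exponential random variable and $R$ a random variable with distribution $\nu_0=\nu$, such that $E$, $R$ and $(N,C,A_1,A_2,\ldots)$ are independent. Let $\bigcup_{n\ge0}\mathbb{N}^n$ ($\mathbb{N}^0=\{\varnothing\}$) be the set of Ulam-Harris labels and equip the vertices $x$ with independent copies $(E(x),R(x),N(x),C(x),A_1(x),A_2(x),\ldots)$ of $(E,R,N,C,A_1,A_2,\ldots)$. The full Galton-Watson tree $\mathcal{T}_\infty$ contains $\varnothing$, and for each $x\in\mathcal{T}_\infty$ the children of $x$ in $\mathcal{T}_\infty$ are $xi$, $1\le i\le N(x)$. Let $|x|$ be the generation (length) of $x$. Birth times $B$, death times $D$ and positions $V$ are defined by $B(\varnothing)=0$, $D(x)=B(x)+E(x)$, $B(xi)=D(x)$, $V(\varnothing)=0$, $V(xi)=V(x)+\log A_i(x)$. For $t\ge0$ let $\partial\mathcal{T}_t=\{x\in\mathcal{T}_\infty: B(x)\le t<D(x)\}$ (particles alive at time $t$) and $\mathcal{T}_t^o=\{x\in\mathcal{T}_\infty: D(x)\le t\}$ (particles dead by time $t$). *)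

theory Defs
  imports "HOL-Probability.Probability"
begin

text \<open>
  State space of the vector (N, C, A_1, A_2, ...): it is
  \<open>{0,1,2,...} \<times> \<real> \<times> (0,\<infinity>)^{1,2,...}\<close>. Sequences are indexed from 0 throughout, so
  component \<open>A k\<close> stands for A_(k+1), and \<open>k < N\<close> for 1 \<le> k+1 \<le> N.
\<close>

definition mark_space :: "(nat \<times> real \<times> (nat \<Rightarrow> real)) measure" where
  "mark_space = count_space UNIV \<Otimes>\<^sub>M borel \<Otimes>\<^sub>M (\<Pi>\<^sub>M k\<in>UNIV. restrict_space borel {0<..})"


section \<open>The Cauchy problem\<close>

definition Q_hat ::
  "'b measure \<Rightarrow> ('b \<Rightarrow> nat) \<Rightarrow> ('b \<Rightarrow> real) \<Rightarrow> ('b \<Rightarrow> nat \<Rightarrow> real) \<Rightarrow> (real \<Rightarrow> complex) \<Rightarrow> real \<Rightarrow> complex"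
where
  "Q_hat \<Omega> N C A \<psi> \<xi> = (CLINT \<omega>|\<Omega>. iexp (\<xi> * C \<omega>) * (\<Prod>k<N \<omega>. \<psi> (A \<omega> k * \<xi>)))"

text \<open>Derivatives are taken within the half-line, i.e. one-sided at 0.\<close>

definition C1_on_halfline :: "(real \<Rightarrow> complex) \<Rightarrow> bool" where
  "C1_on_halfline f \<longleftrightarrow>
    (\<exists>f'. (\<forall>t\<ge>0. (f has_vector_derivative f' t) (at t within {0..})) \<and> continuous_on {0..} f')"

text \<open>
  Functions of time are total on the reals; only their restriction to t \<ge> 0 is constrained.
\<close>

definition solution_class :: "(real \<Rightarrow> real \<Rightarrow> complex) set" where
  "solution_class = {\<phi>.
     (\<forall>t\<ge>0. \<exists>\<mu>. real_distribution \<mu> \<and> \<phi> t = char \<mu>) \<and>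
     (\<forall>\<xi>. C1_on_halfline (\<lambda>t. \<phi> t \<xi>))}"

definition solves_cauchy_problem ::
  "'b measure \<Rightarrow> ('b \<Rightarrow> nat) \<Rightarrow> ('b \<Rightarrow> real) \<Rightarrow> ('b \<Rightarrow> nat \<Rightarrow> real) \<Rightarrow> (real \<Rightarrow> complex)
    \<Rightarrow> (real \<Rightarrow> real \<Rightarrow> complex) \<Rightarrow> bool"
where
  "solves_cauchy_problem \<Omega> N C A \<phi>0 \<phi> \<longleftrightarrow>
     (\<forall>t\<ge>0. \<forall>\<xi>. ((\<lambda>s. \<phi> s \<xi>) has_vector_derivative (Q_hat \<Omega> N C A (\<phi> t) \<xi> - \<phi> t \<xi>))
                    (at t within {0..})) \<and>
     (\<forall>\<xi>. \<phi> 0 \<xi> = \<phi>0 \<xi>)"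


section \<open>Marked continuous-time branching random walk\<close>

text \<open>
  Ulam-Harris labels are stored in reverse: the word x_1 ... x_n is the list
  \<open>[x_n, ..., x_1]\<close>, so the child xi of x is \<open>i # x\<close>.
\<close>

type_synonym label = "nat list"

text \<open>
  The following objects are built from one realization of the marks:
  \<open>e x\<close>, \<open>r x\<close>, \<open>n x\<close>, \<open>c x\<close>, \<open>a x k\<close> are the values of E(x), R(x), N(x), C(x), A_(k+1)(x).
\<close>

inductive_set gw_tree :: "(label \<Rightarrow> nat) \<Rightarrow> label set" for n :: "label \<Rightarrow> nat" where
  root: "[] \<in> gw_tree n"
| child: "x \<in> gw_tree n \<Longrightarrow> i < n x \<Longrightarrow> i # x \<in> gw_tree n"

text \<open>In the second equation, the right-hand side is the death time of the parent.\<close>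

primrec birth_time :: "(label \<Rightarrow> real) \<Rightarrow> label \<Rightarrow> real" where
  "birth_time e [] = 0"
| "birth_time e (i # x) = birth_time e x + e x"

definition death_time :: "(label \<Rightarrow> real) \<Rightarrow> label \<Rightarrow> real" where
  "death_time e x = birth_time e x + e x"

primrec position :: "(label \<Rightarrow> nat \<Rightarrow> real) \<Rightarrow> label \<Rightarrow> real" where
  "position a [] = 0"
| "position a (i # x) = position a x + ln (a x i)"

definition alive :: "(label \<Rightarrow> real) \<Rightarrow> (label \<Rightarrow> nat) \<Rightarrow> real \<Rightarrow> label set" where
  "alive e n t = {x \<in> gw_tree n. birth_time e x \<le> t \<and> t < death_time e x}"

definition dead :: "(label \<Rightarrow> real) \<Rightarrow> (label \<Rightarrow> nat) \<Rightarrow> real \<Rightarrow> label set" where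
  "dead e n t = {x \<in> gw_tree n. death_time e x \<le> t}"

text \<open>
  Both index sets are almost surely finite when the branching process does not explode;
  where an index set is infinite, the corresponding sum is 0 by the library convention.
\<close>

definition W_sum ::
  "(label \<Rightarrow> real) \<Rightarrow> (label \<Rightarrow> real) \<Rightarrow> (label \<Rightarrow> nat) \<Rightarrow> (label \<Rightarrow> real) \<Rightarrow> (label \<Rightarrow> nat \<Rightarrow> real)
    \<Rightarrow> real \<Rightarrow> real"
where
  "W_sum e r n c a t =
     (\<Sum>x\<in>alive e n t. exp (position a x) * r x) + (\<Sum>x\<in>dead e n t. exp (position a x) * c x)"

text \<open>
  The marks of the vertices are independent copies of (E, R, (N, C, A)), whose three blocks
  are independent with laws Exp(1), \<open>\<nu>\<close> and \<open>\<kappa>\<close>; hence the product measure in \<open>law\<close>.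
\<close>

locale marked_ctbrw = prob_space M
  for M :: "'a measure" +
  fixes \<nu> :: "real measure"
    and \<kappa> :: "(nat \<times> real \<times> (nat \<Rightarrow> real)) measure"
    and E :: "label \<Rightarrow> 'a \<Rightarrow> real"
    and R :: "label \<Rightarrow> 'a \<Rightarrow> real"
    and N :: "label \<Rightarrow> 'a \<Rightarrow> nat"
    and C :: "label \<Rightarrow> 'a \<Rightarrow> real"
    and A :: "label \<Rightarrow> 'a \<Rightarrow> nat \<Rightarrow> real"
  assumes indep:
    "indep_vars (\<lambda>_. borel \<Otimes>\<^sub>M borel \<Otimes>\<^sub>M mark_space)
       (\<lambda>x \<omega>. (E x \<omega>, R x \<omega>, N x \<omega>, C x \<omega>, A x \<omega>)) UNIV"
  and law:
    "\<And>x. distr M (borel \<Otimes>\<^sub>M borel \<Otimes>\<^sub>M mark_space) (\<lambda>\<omega>. (E x \<omega>, R x \<omega>, N x \<omega>, C x \<omega>, A x \<omega>))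
       = density lborel (exponential_density 1) \<Otimes>\<^sub>M \<nu> \<Otimes>\<^sub>M \<kappa>"

definition W ::
  "(label \<Rightarrow> 'a \<Rightarrow> real) \<Rightarrow> (label \<Rightarrow> 'a \<Rightarrow> real) \<Rightarrow> (label \<Rightarrow> 'a \<Rightarrow> nat) \<Rightarrow> (label \<Rightarrow> 'a \<Rightarrow> real)
    \<Rightarrow> (label \<Rightarrow> 'a \<Rightarrow> nat \<Rightarrow> real) \<Rightarrow> real \<Rightarrow> 'a \<Rightarrow> real"
where
  "W E R N C A t \<omega> =
     W_sum (\<lambda>x. E x \<omega>) (\<lambda>x. R x \<omega>) (\<lambda>x. N x \<omega>) (\<lambda>x. C x \<omega>) (\<lambda>x. A x \<omega>) t"

end

theory Submission
  imports Defs
begin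

text \<open>
  Condition on the lifetime and the offspring of the first particle. Once it dies, the subtrees of
  its children are independent copies of the whole process, so the characteristic function of \<open>W_t\<close>
  satisfies the Cauchy problem in integrated form,
  \<open>\<phi>_t = exp (-t) * (\<phi>_0 + integral of exp u * Q \<phi>_u over [0, t])\<close>.

  Let \<open>G n t \<xi>\<close> be the expectation of \<open>exp (i \<xi> W_t)\<close> restricted to the event that generation \<open>n\<close>
  has not been entered by time \<open>t\<close>. There the sums are almost surely finite, and the decomposition at the
  root (\<open>G_Suc\<close>) says that \<open>G (n + 1)\<close> arises from \<open>G n\<close> by the right-hand side of the integral
  equation. The limit \<open>G_lim\<close> restricts to the event of non-explosion by time \<open>t\<close>; dominated
  convergence makes it a solution (\<open>G_lim_has_vector_derivative\<close>).

  At \<open>\<xi> = 0\<close> this solution is the probability \<open>w t\<close> of non-explosion by time \<open>t\<close>, and the equation reads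
  \<open>w' = f w - w\<close>, \<open>w 0 = 1\<close>, with \<open>f s = E s^N\<close>. The divergent integral in the hypothesis is Osgood's
  criterion that \<open>w\<close> cannot leave 1 (\<open>osgood_constant\<close>, \<open>p_regular_eq_1\<close>). Hence \<open>G_lim\<close> is the
  characteristic function of \<open>W_t\<close>, which gives existence.

  For uniqueness, let \<open>\<phi>\<close> be any solution. The operator \<open>Q\<close> need not be Lipschitz, because \<open>N\<close> may
  have infinite mean. Instead, the two bounds \<open>|G n t \<xi>| \<le> p n t\<close> and
  \<open>|\<phi>_t \<xi> - G n t \<xi>| \<le> 1 - p n t\<close>, with \<open>p n t\<close> the probability that generation \<open>n\<close> has not
  been entered by time \<open>t\<close>, reproduce themselves under \<open>Q\<close> (\<open>norm_prod_diff_le_1_minus_power\<close>,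
  \<open>difference_le_unconfined\<close>). Since \<open>p n t\<close> tends to \<open>w t = 1\<close>, \<open>\<phi> = G_lim\<close>.
\<close>

section \<open>A product estimate\<close>

text \<open>
  If each \<open>b k\<close> has modulus at most \<open>w\<close> and each remainder \<open>a k - b k\<close> at most \<open>1 - w\<close>, expand the
  product of the sums \<open>b k + (a k - b k)\<close>: all terms except the product of the \<open>b k\<close> are dominated by
  the corresponding terms of \<open>(w + (1 - w)) ^ m - w ^ m\<close>. The bound is preserved by passing to a
  product with any number of factors, which is what the induction over generations requires; the
  bound by the sum of the single differences would be useless when \<open>N\<close> has infinite mean.
\<close>

lemma norm_prod_diff_le_1_minus_power:
  fixes a b :: "nat \<Rightarrow> complex"
  assumes a: "\<And>k. norm (a k) \<le> 1" and b: "\<And>k. norm (b k) \<le> w"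
    and ab: "\<And>k. norm (a k - b k) \<le> 1 - w"
  shows "norm ((\<Prod>k<m. a k) - (\<Prod>k<m. b k)) \<le> 1 - w ^ m"
proof (induction m)
  case (Suc m)
  have "0 \<le> w" using b[of 0] norm_ge_zero order_trans by blast
  have "norm (\<Prod>k<m. b k) \<le> (\<Prod>k<m. w)"
    unfolding prod_norm[symmetric] by (intro prod_mono) (use b in auto)
  then have pb: "norm (\<Prod>k<m. b k) \<le> w ^ m" by simp
  have "(\<Prod>k<Suc m. a k) - (\<Prod>k<Suc m. b k) =
      ((\<Prod>k<m. a k) - (\<Prod>k<m. b k)) * a m + (\<Prod>k<m. b k) * (a m - b m)"
    by (simp add: algebra_simps)
  also have "norm \<dots> \<le> (1 - w ^ m) * 1 + w ^ m * (1 - w)"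
  proof (intro norm_triangle_mono)
    show "norm (((\<Prod>k<m. a k) - (\<Prod>k<m. b k)) * a m) \<le> (1 - w ^ m) * 1"
      unfolding norm_mult by (rule mult_mono) (use Suc a order_trans[OF norm_ge_zero Suc] in auto)
    show "norm ((\<Prod>k<m. b k) * (a m - b m)) \<le> w ^ m * (1 - w)"
      unfolding norm_mult by (rule mult_mono) (use pb ab \<open>0 \<le> w\<close> in auto)
  qed
  finally show ?case by (simp add: algebra_simps)
qed simp

section \<open>The integral form of y' = q - y\<close>

text \<open>
  Multiplying by the integrating factor \<open>exp\<close> turns \<open>y' = q - y\<close> into
  \<open>y t = exp (-t) * (y 0 + integral of exp u * q u over [0, t])\<close>. With merely bounded measurable
  \<open>q\<close> the right-hand side is continuous in \<open>t\<close>, with continuous \<open>q\<close> it solves the differential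
  equation. Applied in this order, the facts below upgrade a measurable solution of the integral
  equation to a continuously differentiable solution of the differential equation.
\<close>

lemma set_integrable_exp_bounded:
  fixes q :: "real \<Rightarrow> 'a :: euclidean_space"
  assumes meas: "q \<in> borel_measurable borel" and bdd: "\<And>u. norm (q u) \<le> 1"
  shows "set_integrable lborel {0..t} (\<lambda>u. exp u *\<^sub>R q u)"
proof -
  have "set_integrable lborel {0..t} (\<lambda>u. exp u :: real)"
    by (intro borel_integrable_atLeastAtMost' continuous_intros)
  then show ?thesis
    unfolding set_integrable_def
    by (rule Bochner_Integration.integrable_bound)
       (use meas bdd in \<open>auto simp: indicator_def mult_left_le\<close>)
qed

lemma continuous_on_duhamel:
  fixes q :: "real \<Rightarrow> 'a :: euclidean_space"
  assumes meas: "q \<in> borel_measurable borel" and bdd: "\<And>u. norm (q u) \<le> 1"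
  shows "continuous_on {0..} (\<lambda>t. exp (-t) *\<^sub>R (c + (LBINT u:{0..t}. exp u *\<^sub>R q u)))"
proof -
  note int = set_integrable_exp_bounded[OF meas bdd]
  have "continuous_on {0..<b} (\<lambda>t. exp (-t) *\<^sub>R (c + (LBINT u:{0..t}. exp u *\<^sub>R q u)))" for b
  proof -
    have "continuous_on {0..b} (\<lambda>t. integral {0..t} (\<lambda>u. exp u *\<^sub>R q u))"
      by (intro indefinite_integral_continuous_1 set_borel_integral_eq_integral int)
    then have "continuous_on {0..b} (\<lambda>t. LBINT u:{0..t}. exp u *\<^sub>R q u)"
      by (subst set_borel_integral_eq_integral(2)[OF int])
    then have "continuous_on {0..b} (\<lambda>t. exp (-t) *\<^sub>R (c + (LBINT u:{0..t}. exp u *\<^sub>R q u)))"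
      by (intro continuous_intros)
    then show ?thesis by (rule continuous_on_subset) auto
  qed
  then have *: "continuous (at x within {0..<x+1}) (\<lambda>t. exp (-t) *\<^sub>R (c + (LBINT u:{0..t}. exp u *\<^sub>R q u)))"
    if "x \<ge> 0" for x
    using that by (auto simp: continuous_on_eq_continuous_within)
  have "at x within {0..<x+1} = at x within {0..}" for x :: real
    by (rule at_within_nhd[of x "{..<x+1}"]) auto
  with * show ?thesis by (simp add: continuous_on_eq_continuous_within)
qed

lemma has_vector_derivative_duhamel:
  fixes q :: "real \<Rightarrow> 'a :: euclidean_space" and c :: 'a
  assumes q: "continuous_on {0..} q" and t: "t \<ge> 0"
  defines "P \<equiv> (\<lambda>t. exp (-t) *\<^sub>R (c + (LBINT u:{0..t}. exp u *\<^sub>R q u)))"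
  shows "(P has_vector_derivative q t - P t) (at t within {0..})"
proof -
  have cont: "continuous_on {0..b} (\<lambda>u. exp u *\<^sub>R q u)" for b
    by (intro continuous_intros continuous_on_subset[OF q]) auto
  have eq: "(LBINT u:{0..b}. exp u *\<^sub>R q u) = integral {0..b} (\<lambda>u. exp u *\<^sub>R q u)" for b
    by (intro set_borel_integral_eq_integral borel_integrable_atLeastAtMost' cont)
  have "((\<lambda>b. integral {0..b} (\<lambda>u. exp u *\<^sub>R q u)) has_vector_derivative exp t *\<^sub>R q t) (at t within {0..t+1})"
    by (intro integral_has_vector_derivative cont) (use t in auto)
  moreover have "at t within {0..t+1} = at t within {0..}"
    by (rule at_within_nhd[of t "{..<t+1}"]) auto
  ultimately have *: "((\<lambda>b. LBINT u:{0..b}. exp u *\<^sub>R q u) has_vector_derivative exp t *\<^sub>R q t) (at t within {0..})"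
    unfolding eq by simp
  have "((\<lambda>t. exp (-t)) has_real_derivative - exp (-t)) (at t within {0..})"
    by (auto intro!: derivative_eq_intros)
  from has_vector_derivative_scaleR[OF this has_vector_derivative_add[OF has_vector_derivative_const *]]
  have "(P has_vector_derivative exp (-t) *\<^sub>R (0 + exp t *\<^sub>R q t) + (- exp (-t)) *\<^sub>R (c + (LBINT u:{0..t}. exp u *\<^sub>R q u)))
     (at t within {0..})"
    unfolding P_def .
  then show ?thesis by (simp add: P_def exp_minus)
qed

lemma duhamel_formula:
  fixes q y :: "real \<Rightarrow> 'a :: euclidean_space"
  assumes deriv: "\<And>t. t \<ge> 0 \<Longrightarrow> (y has_vector_derivative q t - y t) (at t within {0..})"
    and q: "continuous_on {0..} q" and t: "t \<ge> 0"
  shows "y t = exp (-t) *\<^sub>R (y 0 + (LBINT u:{0..t}. exp u *\<^sub>R q u))"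
proof -
  have cont: "continuous_on {0..t} (\<lambda>u. exp u *\<^sub>R q u)"
    by (intro continuous_intros continuous_on_subset[OF q]) auto
  have d: "((\<lambda>u. exp u *\<^sub>R y u) has_vector_derivative exp x *\<^sub>R q x) (at x within {0..t})" if "0 \<le> x" for x
  proof -
    have "((\<lambda>u. exp u) has_real_derivative exp x) (at x within {0..})"
      by (auto intro!: derivative_eq_intros)
    from has_vector_derivative_scaleR[OF this deriv[OF that]]
    have "((\<lambda>u. exp u *\<^sub>R y u) has_vector_derivative exp x *\<^sub>R q x) (at x within {0..})"
      by (simp add: algebra_simps)
    then show ?thesis by (rule has_vector_derivative_within_subset) auto
  qed
  have "(LBINT u:{0..t}. exp u *\<^sub>R q u) = exp t *\<^sub>R y t - exp 0 *\<^sub>R y 0"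
    unfolding set_lebesgue_integral_def
    by (rule integral_FTC_atLeastAtMost[OF t d cont])
  then show ?thesis by (simp add: exp_minus)
qed

section \<open>An Osgood criterion\<close>

text \<open>
  A solution of \<open>w' = f w - w\<close> that leaves the equilibrium 1 and reaches \<open>1 - \<epsilon>\<close> at time \<open>t\<^sub>2\<close>
  would need the time \<open>integral of ds / (s - f s) over [1 - \<epsilon>, 1]\<close> for this, as the substitution
  \<open>s = w t\<close> shows. So the divergence of that integral pins \<open>w\<close> at 1. Convexity of \<open>f\<close> enters because
  the integrand encodes negative values as 0: divergence only provides single points \<open>s\<^sub>0\<close> near 1
  with \<open>f s\<^sub>0 \<le> s\<^sub>0\<close>, and convexity together with \<open>f 1 = 1\<close> extends this to \<open>[s\<^sub>0, 1]\<close>.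
\<close>

lemma osgood_constant:
  fixes f w :: "real \<Rightarrow> real"
  assumes f_meas: "f \<in> borel_measurable borel" and f_cont: "continuous_on {0..1} f"
    and f_convex: "convex_on {0..1} f" and f_1: "f 1 = 1"
    and diverges: "\<forall>\<^sub>F \<epsilon> in at_right (0::real).
      (\<integral>\<^sup>+ s\<in>{1 - \<epsilon>..1}. ennreal (1 / (s - f s)) \<partial>lborel) = \<infinity>"
    and w_bounds: "\<And>t. 0 \<le> t \<Longrightarrow> 0 \<le> w t \<and> w t \<le> 1"
    and w_antimono: "\<And>s t. 0 \<le> s \<Longrightarrow> s \<le> t \<Longrightarrow> w t \<le> w s"
    and w_0: "w 0 = 1"
    and w_deriv: "\<And>t. 0 \<le> t \<Longrightarrow> (w has_real_derivative f (w t) - w t) (at t within {0..})"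
    and t: "0 \<le> t"
  shows "w t = 1"
proof (rule ccontr)
  assume "w t \<noteq> 1"
  then have wt: "w t < 1" using w_bounds[OF t] by auto
  obtain \<epsilon>\<^sub>0 where e0: "\<epsilon>\<^sub>0 > 0"
    "\<And>\<epsilon>. 0 < \<epsilon> \<Longrightarrow> \<epsilon> < \<epsilon>\<^sub>0 \<Longrightarrow> (\<integral>\<^sup>+ s\<in>{1 - \<epsilon>..1}. ennreal (1 / (s - f s)) \<partial>lborel) = \<infinity>"
    using diverges unfolding eventually_at_right_field by auto
  \<comment> \<open>If \<open>f s > s\<close> held throughout \<open>[1 - \<epsilon>\<^sub>1, 1)\<close>, the integrand would vanish there.\<close>
  define \<epsilon>\<^sub>1 where "\<epsilon>\<^sub>1 = min (\<epsilon>\<^sub>0 / 2) 1"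
  obtain s\<^sub>0 where s0: "1 - \<epsilon>\<^sub>1 \<le> s\<^sub>0" "s\<^sub>0 < 1" "f s\<^sub>0 \<le> s\<^sub>0"
  proof (rule ccontr)
    assume neg: "\<not> thesis"
    have "(\<integral>\<^sup>+ s\<in>{1 - \<epsilon>\<^sub>1..1}. ennreal (1 / (s - f s)) \<partial>lborel) = (\<integral>\<^sup>+ (s::real). 0 \<partial>lborel)"
    proof (intro nn_integral_cong)
      fix s
      show "ennreal (1 / (s - f s)) * indicator {1 - \<epsilon>\<^sub>1..1} s = 0"
      proof (cases "s \<in> {1 - \<epsilon>\<^sub>1..1}")
        case True
        then have "s = 1 \<or> f s > s" using neg that[of s] by fastforce
        then show ?thesis using f_1 by (auto simp: ennreal_neg divide_nonneg_neg ennreal_eq_0_iff)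
      qed simp
    qed
    then show False using e0(2)[of \<epsilon>\<^sub>1] e0(1) by (simp add: \<epsilon>\<^sub>1_def min_def split: if_splits)
  qed
  have f_le: "f s \<le> s" if "s\<^sub>0 \<le> s" "s \<le> 1" for s
  proof -
    define \<theta> where "\<theta> = (s - s\<^sub>0) / (1 - s\<^sub>0)"
    have th: "0 \<le> \<theta>" "\<theta> \<le> 1"
      using that s0 by (auto simp: \<theta>_def field_simps)
    have "\<theta> * (1 - s\<^sub>0) = s - s\<^sub>0" using s0 by (simp add: \<theta>_def)
    then have s: "s = (1 - \<theta>) *\<^sub>R s\<^sub>0 + \<theta> *\<^sub>R 1" by (simp add: algebra_simps)
    have "f s \<le> (1 - \<theta>) * f s\<^sub>0 + \<theta> * f 1"
      unfolding s by (rule convex_onD[OF f_convex]) (use th s0 \<epsilon>\<^sub>1_def in auto)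
    also have "\<dots> \<le> (1 - \<theta>) * s\<^sub>0 + \<theta>"
      using s0(3) th f_1 by (auto intro!: mult_left_mono)
    finally show ?thesis unfolding s by simp
  qed
  define \<epsilon> where "\<epsilon> = min (\<epsilon>\<^sub>0 / 2) (min (1 - s\<^sub>0) (1 - w t))"
  have eps: "0 < \<epsilon>" "\<epsilon> < \<epsilon>\<^sub>0" "s\<^sub>0 \<le> 1 - \<epsilon>" "w t \<le> 1 - \<epsilon>"
    using e0(1) s0(2) wt by (auto simp: \<epsilon>_def min_def)
  have w_cont: "continuous_on {0..} w"
    using w_deriv by (intro DERIV_continuous_on) auto
  obtain t\<^sub>2 where t2: "0 \<le> t\<^sub>2" "t\<^sub>2 \<le> t" "w t\<^sub>2 = 1 - \<epsilon>"
    using IVT2'[of w t "1 - \<epsilon>" 0] eps w_0 t continuous_on_subset[OF w_cont, of "{0..t}"] by auto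
  have t2_pos: "0 < t\<^sub>2" using t2 w_0 eps by (cases "t\<^sub>2 = 0") auto
  \<comment> \<open>The substitution rule asks for two-sided derivatives, also at time 0. Continuing \<open>w\<close> by its
    initial value 1 keeps it differentiable there, since its right derivative is \<open>f 1 - 1 = 0\<close>.\<close>
  define v where "v s = (if s < 0 then 1 else w s)" for s
  have v_deriv: "(v has_real_derivative f (w s) - w s) (at s)" if "0 \<le> s" for s
  proof (cases "s = 0")
    case False
    have "(w has_real_derivative f (w s) - w s) (at s)"
      using w_deriv[OF that] at_within_interior[of s "{0..}"] that False by simp
    then show ?thesis
      by (rule DERIV_cong_ev[THEN iffD1, rotated 3])
         (use that False in \<open>auto simp: v_def eventually_nhds intro!: exI[of _ "{0<..}"]\<close>)
  next
    case True
    have l: "((\<lambda>y. (v y - v 0) / (y - 0)) \<longlongrightarrow> 0) (at_left 0)"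
      by (rule tendsto_eventually) (auto simp: v_def w_0 eventually_at_left_field intro!: exI[of _ "-1"])
    have "((\<lambda>y. (w y - w 0) / (y - 0)) \<longlongrightarrow> 0) (at 0 within {0..})"
      using w_deriv[of 0] f_1 w_0 by (simp add: has_field_derivative_iff)
    then have "((\<lambda>y. (w y - w 0) / (y - 0)) \<longlongrightarrow> 0) (at_right 0)"
      by (rule tendsto_within_subset) auto
    then have r: "((\<lambda>y. (v y - v 0) / (y - 0)) \<longlongrightarrow> 0) (at_right 0)"
      by (rule Lim_transform_eventually) (auto simp: v_def eventually_at_right_field intro!: exI[of _ 1])
    show ?thesis
      using filterlim_split_at[OF l r] True f_1 w_0 by (simp add: has_field_derivative_iff)
  qed
  \<comment> \<open>Time is reversed to obtain a nondecreasing function.\<close>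
  define g where "g x = v (t\<^sub>2 - x)" for x
  have g_eq: "g x = w (t\<^sub>2 - x)" if "x \<le> t\<^sub>2" for x
    using that by (simp add: g_def v_def)
  have g_deriv: "(g has_real_derivative g x - f (g x)) (at x)" if "x \<in> {0..t\<^sub>2}" for x
  proof -
    have "(g has_real_derivative (f (w (t\<^sub>2 - x)) - w (t\<^sub>2 - x)) * (-1)) (at x)"
      unfolding g_def
      by (rule DERIV_chain2[OF v_deriv]) (use that in \<open>auto intro!: derivative_eq_intros\<close>)
    then show ?thesis using g_eq[of x] that by simp
  qed
  have g_range: "g x \<in> {1 - \<epsilon>..1}" if "x \<in> {0..t\<^sub>2}" for x
    using that w_antimono[of "t\<^sub>2 - x" t\<^sub>2] w_bounds[of "t\<^sub>2 - x"] t2 by (simp add: g_eq)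
  have g_cont: "continuous_on {0..t\<^sub>2} g"
    using g_deriv by (intro DERIV_continuous_on) (auto intro: has_field_derivative_at_within)
  have "(\<integral>\<^sup>+ s. ennreal (1 / (s - f s)) * indicator {g 0..g t\<^sub>2} s \<partial>lborel) =
      (\<integral>\<^sup>+ x. ennreal (1 / (g x - f (g x))) * ennreal (g x - f (g x)) * indicator {0..t\<^sub>2} x \<partial>lborel)"
  proof (rule nn_integral_substitution_aux)
    show "continuous_on {0..t\<^sub>2} (\<lambda>x. g x - f (g x))"
      by (intro continuous_intros g_cont continuous_on_compose2[OF f_cont])
         (use g_range s0 \<epsilon>\<^sub>1_def eps in force)
    show "0 \<le> g x - f (g x)" if "x \<in> {0..t\<^sub>2}" for x
      using f_le[of "g x"] g_range[OF that] eps by auto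
  qed (use f_meas g_deriv t2_pos in auto)
  also have "\<dots> \<le> (\<integral>\<^sup>+ x. indicator {0..t\<^sub>2} x \<partial>lborel)"
  proof (intro nn_integral_mono)
    fix x :: real
    \<comment> \<open>The product is 1 except where \<open>y \<le> 0\<close>, and there it is 0.\<close>
    have "ennreal (1 / y) * ennreal y \<le> 1" for y :: real
      by (cases "y > 0") (auto simp: ennreal_mult[symmetric] ennreal_neg)
    then show "ennreal (1 / (g x - f (g x))) * ennreal (g x - f (g x)) * indicator {0..t\<^sub>2} x \<le> indicator {0..t\<^sub>2} x"
      by (auto simp: indicator_def)
  qed
  also have "\<dots> < \<infinity>" using t2(1) by simp
  finally show False
    using e0(2)[OF eps(1,2)] t2 w_0 by (simp add: g_def v_def)
qed

section \<open>Splitting a marked tree at its root\<close>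

type_synonym mark = "real \<times> real \<times> nat \<times> real \<times> (nat \<Rightarrow> real)"

abbreviation mark_E :: "(label \<Rightarrow> mark) \<Rightarrow> label \<Rightarrow> real" where
  "mark_E X x \<equiv> fst (X x)"
abbreviation mark_R :: "(label \<Rightarrow> mark) \<Rightarrow> label \<Rightarrow> real" where
  "mark_R X x \<equiv> fst (snd (X x))"
abbreviation mark_N :: "(label \<Rightarrow> mark) \<Rightarrow> label \<Rightarrow> nat" where
  "mark_N X x \<equiv> fst (snd (snd (X x)))"
abbreviation mark_C :: "(label \<Rightarrow> mark) \<Rightarrow> label \<Rightarrow> real" where
  "mark_C X x \<equiv> fst (snd (snd (snd (X x))))"
abbreviation mark_A :: "(label \<Rightarrow> mark) \<Rightarrow> label \<Rightarrow> nat \<Rightarrow> real" where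
  "mark_A X x \<equiv> snd (snd (snd (snd (X x))))"

definition W_of :: "real \<Rightarrow> (label \<Rightarrow> mark) \<Rightarrow> real" where
  "W_of t X = W_sum (mark_E X) (mark_R X) (mark_N X) (mark_C X) (mark_A X) t"

text \<open>Labels are stored in reverse, so the descendants of the root's child \<open>i\<close> end with \<open>i\<close>.\<close>

definition subtree :: "nat \<Rightarrow> (label \<Rightarrow> mark) \<Rightarrow> label \<Rightarrow> mark" where
  "subtree i X = (\<lambda>y. X (y @ [i]))"

text \<open>
  By time \<open>t\<close>, the branching random walk has not entered generation \<open>n\<close> or a later one. Later
  generations are mentioned because lifetimes are arbitrary reals here; this makes the condition
  monotone in \<open>n\<close> for every realization.
\<close>

definition confined :: "nat \<Rightarrow> real \<Rightarrow> (label \<Rightarrow> mark) \<Rightarrow> bool" where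
  "confined n t X \<longleftrightarrow> (\<forall>x \<in> gw_tree (mark_N X). n \<le> length x \<longrightarrow> t < birth_time (mark_E X) x)"

inductive_simps gw_tree_Cons: "i # x \<in> gw_tree n"

lemma gw_tree_snoc: "y @ [i] \<in> gw_tree n \<longleftrightarrow> i < n [] \<and> y \<in> gw_tree (\<lambda>z. n (z @ [i]))"
  by (induction y) (auto simp: gw_tree_Cons intro: gw_tree.root)

lemma birth_time_snoc: "birth_time e (y @ [i]) = e [] + birth_time (\<lambda>z. e (z @ [i])) y"
  by (induction y) auto

lemma position_snoc: "position a (y @ [i]) = ln (a [] i) + position (\<lambda>z. a (z @ [i])) y"
  by (induction y) auto

lemma birth_time_nonneg: "(\<And>x. 0 \<le> e x) \<Longrightarrow> 0 \<le> birth_time e x"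
  by (induction x) auto

lemma finite_gw_tree_level: "finite {x \<in> gw_tree n. length x < k}"
proof (induction k)
  case (Suc k)
  have "{x \<in> gw_tree n. length x < Suc k} \<subseteq>
      insert [] (\<Union>x\<in>{x \<in> gw_tree n. length x < k}. (\<lambda>i. i # x) ` {..<n x})"
  proof
    fix x assume "x \<in> {x \<in> gw_tree n. length x < Suc k}"
    then show "x \<in> insert [] (\<Union>x\<in>{x \<in> gw_tree n. length x < k}. (\<lambda>i. i # x) ` {..<n x})"
      by (cases x) (auto simp: gw_tree_Cons)
  qed
  then show ?case by (rule finite_subset) (use Suc in auto)
qed simp

lemma confined_mono: "confined n t X \<Longrightarrow> n \<le> m \<Longrightarrow> confined m t X"
  unfolding confined_def by (meson order_trans)

lemma confined_antimono_time: "confined n t X \<Longrightarrow> s \<le> t \<Longrightarrow> confined n s X"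
  unfolding confined_def by (meson order_le_less_trans)

lemma not_confined_0: "0 \<le> t \<Longrightarrow> \<not> confined 0 t X"
  unfolding confined_def using gw_tree.root[of "mark_N X"] by (auto intro!: bexI[of _ "[]"])

lemma label_cases:
  obtains "x = []" | y i where "x = y @ [i :: nat]"
  by (cases x rule: rev_cases) auto

text \<open>
  The recursion holds for every realization: if the root lives beyond \<open>t\<close>, then the subtrees are
  asked about a negative time.
\<close>

lemma confined_Suc:
  "confined (Suc n) t X \<longleftrightarrow> (\<forall>i < mark_N X []. confined n (t - mark_E X []) (subtree i X))"
proof -
  have "confined (Suc n) t X \<longleftrightarrow>
      (\<forall>i y. y @ [i] \<in> gw_tree (mark_N X) \<longrightarrow> n \<le> length y \<longrightarrow> t < birth_time (mark_E X) (y @ [i]))"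
    unfolding confined_def
  proof (intro iffI ballI allI impI)
    fix x assume *: "\<forall>i y. y @ [i] \<in> gw_tree (mark_N X) \<longrightarrow> n \<le> length y \<longrightarrow> t < birth_time (mark_E X) (y @ [i])"
      and "x \<in> gw_tree (mark_N X)" "Suc n \<le> length x"
    then show "t < birth_time (mark_E X) x" by (cases x rule: label_cases) auto
  qed auto
  then show ?thesis
    unfolding confined_def subtree_def gw_tree_snoc birth_time_snoc
    by (auto simp: less_diff_eq algebra_simps)
qed

lemma confined_before_first_split:
  assumes "\<And>x. 0 \<le> mark_E X x" and "t < mark_E X []"
  shows "confined (Suc n) t X"
  unfolding confined_Suc unfolding confined_def
proof (intro allI ballI impI)
  fix i x
  have "0 \<le> birth_time (mark_E (subtree i X)) x"
    by (rule birth_time_nonneg) (simp add: assms subtree_def)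
  then show "t - mark_E X [] < birth_time (mark_E (subtree i X)) x" using assms(2) by simp
qed

lemma W_of_before_first_split:
  assumes e: "\<And>x. 0 \<le> mark_E X x" and t: "0 \<le> t" "t < mark_E X []"
  shows "W_of t X = mark_R X []"
proof -
  have late: "t < birth_time (mark_E X) (y @ [i])" for y i
    using birth_time_nonneg[of "\<lambda>z. mark_E X (z @ [i])" y] e t by (simp add: birth_time_snoc)
  have "alive (mark_E X) (mark_N X) t = {[]}"
  proof (intro set_eqI)
    fix x show "x \<in> alive (mark_E X) (mark_N X) t \<longleftrightarrow> x \<in> {[]}"
      using late t by (cases x rule: label_cases) (auto simp: alive_def death_time_def gw_tree.root not_less[symmetric])
  qed
  moreover have "dead (mark_E X) (mark_N X) t = {}"
  proof (intro set_eqI)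
    fix x show "x \<in> dead (mark_E X) (mark_N X) t \<longleftrightarrow> x \<in> {}"
    proof (cases x rule: label_cases)
      case (2 y i)
      then show ?thesis using late[of y i] e[of x] by (simp add: dead_def death_time_def)
    qed (use t in \<open>simp add: dead_def death_time_def\<close>)
  qed
  ultimately show ?thesis by (simp add: W_of_def W_sum_def)
qed

text \<open>
  Sums over infinite sets are 0 by convention and would break additivity over subtrees; this is
  why the recursion for \<open>W_of\<close> is restricted to confined subtrees.
\<close>

lemma confined_finite:
  assumes e: "\<And>x. 0 \<le> mark_E X x" and c: "confined n t X"
  shows "finite (alive (mark_E X) (mark_N X) t)" "finite (dead (mark_E X) (mark_N X) t)"
proof -
  have *: "length x < n" if "x \<in> gw_tree (mark_N X)" "birth_time (mark_E X) x \<le> t" for x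
    using c that unfolding confined_def by (meson linorder_not_less)
  show "finite (alive (mark_E X) (mark_N X) t)"
    by (rule finite_subset[OF _ finite_gw_tree_level[of "mark_N X" n]]) (auto simp: alive_def *)
  have "birth_time (mark_E X) x \<le> t" if "death_time (mark_E X) x \<le> t" for x
    using e[of x] that by (simp add: death_time_def)
  then show "finite (dead (mark_E X) (mark_N X) t)"
    by (intro finite_subset[OF _ finite_gw_tree_level[of "mark_N X" n]]) (auto simp: dead_def *)
qed

lemma sum_over_subtrees:
  fixes g :: "label \<Rightarrow> real"
  assumes "\<And>i. i < k \<Longrightarrow> finite (S i)"
  shows "(\<Sum>x\<in>(\<Union>i<k. (\<lambda>y. y @ [i]) ` S i). g x) = (\<Sum>i<k. \<Sum>y\<in>S i. g (y @ [i]))"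
proof -
  have "(\<Sum>x\<in>(\<Union>i<k. (\<lambda>y. y @ [i]) ` S i). g x) = (\<Sum>i<k. \<Sum>x\<in>(\<lambda>y. y @ [i]) ` S i. g x)"
    by (rule sum.UNION_disjoint) (use assms in auto)
  also have "\<dots> = (\<Sum>i<k. \<Sum>y\<in>S i. g (y @ [i]))"
    by (simp add: sum.reindex inj_on_def)
  finally show ?thesis .
qed

lemma W_of_after_first_split:
  assumes e: "\<And>x. 0 \<le> mark_E X x" and t: "mark_E X [] \<le> t"
    and c: "\<And>i. i < mark_N X [] \<Longrightarrow> confined n (t - mark_E X []) (subtree i X)"
    and a: "\<And>i. 0 < mark_A X [] i"
  shows "W_of t X = mark_C X [] +
    (\<Sum>i<mark_N X []. mark_A X [] i * W_of (t - mark_E X []) (subtree i X))"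
proof -
  let ?s = "t - mark_E X []"
  let ?al = "\<lambda>i. alive (mark_E (subtree i X)) (mark_N (subtree i X)) ?s"
  let ?de = "\<lambda>i. dead (mark_E (subtree i X)) (mark_N (subtree i X)) ?s"
  have e': "0 \<le> mark_E (subtree i X) x" for i x by (simp add: subtree_def e)
  have fin: "finite (?al i)" "finite (?de i)" if "i < mark_N X []" for i
    using confined_finite[OF e' c[OF that]] by auto
  have al: "alive (mark_E X) (mark_N X) t = (\<Union>i<mark_N X []. (\<lambda>y. y @ [i]) ` ?al i)"
  proof (intro set_eqI)
    fix x show "x \<in> alive (mark_E X) (mark_N X) t \<longleftrightarrow> x \<in> (\<Union>i<mark_N X []. (\<lambda>y. y @ [i]) ` ?al i)"
      using t by (cases x rule: label_cases)
        (auto simp: alive_def death_time_def gw_tree_snoc birth_time_snoc subtree_def algebra_simps)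
  qed
  have de: "dead (mark_E X) (mark_N X) t = insert [] (\<Union>i<mark_N X []. (\<lambda>y. y @ [i]) ` ?de i)"
  proof (intro set_eqI)
    fix x show "x \<in> dead (mark_E X) (mark_N X) t \<longleftrightarrow> x \<in> insert [] (\<Union>i<mark_N X []. (\<lambda>y. y @ [i]) ` ?de i)"
      using t by (cases x rule: label_cases)
        (auto simp: dead_def death_time_def gw_tree_snoc birth_time_snoc subtree_def algebra_simps gw_tree.root)
  qed
  have pos: "exp (position (mark_A X) (y @ [i])) = mark_A X [] i * exp (position (mark_A (subtree i X)) y)" for y i
    by (simp add: position_snoc exp_add a subtree_def)
  have "W_of t X = (\<Sum>i<mark_N X []. \<Sum>y\<in>?al i. exp (position (mark_A X) (y @ [i])) * mark_R X (y @ [i]))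
     + (mark_C X [] + (\<Sum>i<mark_N X []. \<Sum>y\<in>?de i. exp (position (mark_A X) (y @ [i])) * mark_C X (y @ [i])))"
    unfolding W_of_def W_sum_def al de
    by (subst sum.insert) (auto simp: sum_over_subtrees fin)
  also have "\<dots> = mark_C X [] + (\<Sum>i<mark_N X []. mark_A X [] i * W_of ?s (subtree i X))"
    unfolding pos W_of_def W_sum_def
    by (simp add: sum.distrib sum_distrib_left distrib_left mult.assoc) (simp add: subtree_def)
  finally show ?thesis .
qed

section \<open>Measurability\<close>

abbreviation mark_algebra :: "mark measure" where
  "mark_algebra \<equiv> borel \<Otimes>\<^sub>M borel \<Otimes>\<^sub>M mark_space"

abbreviation tree_algebra :: "(label \<Rightarrow> mark) measure" where
  "tree_algebra \<equiv> \<Pi>\<^sub>M x\<in>UNIV. mark_algebra"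

lemma measurable_marks [measurable]:
  "(\<lambda>X. mark_E X x) \<in> borel_measurable tree_algebra"
  "(\<lambda>X. mark_R X x) \<in> borel_measurable tree_algebra"
  "(\<lambda>X. mark_N X x) \<in> tree_algebra \<rightarrow>\<^sub>M count_space UNIV"
  "(\<lambda>X. mark_C X x) \<in> borel_measurable tree_algebra"
  unfolding mark_space_def by measurable

lemma measurable_vector [measurable]:
  "fst \<in> mark_space \<rightarrow>\<^sub>M count_space UNIV"
  "(\<lambda>v. fst (snd v)) \<in> borel_measurable mark_space"
  "(\<lambda>v. snd (snd v) k) \<in> borel_measurable mark_space"
proof -
  have "(\<lambda>v. snd (snd v) k) \<in> mark_space \<rightarrow>\<^sub>M restrict_space borel {0<..}"
    unfolding mark_space_def by measurable
  then show "(\<lambda>v. snd (snd v) k) \<in> borel_measurable mark_space"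
    by (simp add: measurable_restrict_space2_iff)
qed (unfold mark_space_def, measurable)

lemma measurable_mark_A [measurable]: "(\<lambda>X. mark_A X x k) \<in> borel_measurable tree_algebra"
  by (rule measurable_compose[OF _ measurable_vector(3)]) measurable

lemma mark_A_pos: "X \<in> space tree_algebra \<Longrightarrow> 0 < mark_A X x k"
  unfolding mark_space_def
  by (auto simp: space_PiM space_pair_measure space_restrict_space mem_Times_iff PiE_iff Pi_iff)

lemma measurable_gw_tree [measurable]: "Measurable.pred tree_algebra (\<lambda>X. x \<in> gw_tree (mark_N X))"
  by (induction x) (auto simp: gw_tree_Cons gw_tree.root)

lemma measurable_birth_time [measurable]: "(\<lambda>X. birth_time (mark_E X) x) \<in> borel_measurable tree_algebra"
  by (induction x) auto

lemma measurable_position [measurable]: "(\<lambda>X. position (mark_A X) x) \<in> borel_measurable tree_algebra"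
  by (induction x) auto

lemma measurable_confined [measurable]:
  "Measurable.pred (borel \<Otimes>\<^sub>M tree_algebra) (\<lambda>p. confined n (fst p) (snd p))"
  unfolding confined_def Ball_def by measurable

text \<open>
  Where the random set is finite, the partial sums over an enumeration of the index type become
  constant, so that the sum is their limit; elsewhere it is 0 by convention.
\<close>

lemma borel_measurable_sum_random_set:
  fixes S :: "'x \<Rightarrow> 'i :: countable set" and g :: "'i \<Rightarrow> 'x \<Rightarrow> real"
  assumes [measurable]: "\<And>i. Measurable.pred M (\<lambda>x. i \<in> S x)" "\<And>i. g i \<in> borel_measurable M"
  shows "(\<lambda>x. \<Sum>i\<in>S x. g i x) \<in> borel_measurable M"
proof -
  have fin: "finite {i :: 'i. to_nat i < n}" for n
    by (rule finite_inverse_image[of "{..<n}" to_nat, unfolded lessThan_iff]) auto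
  let ?s = "\<lambda>n x. \<Sum>i\<in>{i. to_nat i < n}. if i \<in> S x then g i x else 0"
  have fin_iff: "finite (S x) \<longleftrightarrow> (\<exists>n. \<forall>i. i \<in> S x \<longrightarrow> to_nat i < n)" for x
  proof
    assume "finite (S x)"
    then have "\<forall>i. i \<in> S x \<longrightarrow> to_nat i < Suc (Max (to_nat ` S x))"
      by (simp add: less_Suc_eq_le)
    then show "\<exists>n. \<forall>i. i \<in> S x \<longrightarrow> to_nat i < n" ..
  next
    assume "\<exists>n. \<forall>i. i \<in> S x \<longrightarrow> to_nat i < n"
    then obtain n where "S x \<subseteq> {i. to_nat i < n}" by blast
    then show "finite (S x)" by (rule finite_subset) (rule fin)
  qed
  have "(\<Sum>i\<in>S x. g i x) = (if \<exists>n. \<forall>i. i \<in> S x \<longrightarrow> to_nat i < n then lim (\<lambda>n. ?s n x) else 0)" for x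
  proof (cases "finite (S x)")
    case True
    then obtain m where m: "\<And>i. i \<in> S x \<Longrightarrow> to_nat i < m" using fin_iff by blast
    have "?s n x = (\<Sum>i\<in>S x. g i x)" if "m \<le> n" for n
    proof -
      have "{i. to_nat i < n} \<inter> S x = S x" using m that by (auto intro: less_le_trans)
      then show ?thesis by (simp add: sum.inter_restrict[OF fin, symmetric])
    qed
    then have "\<forall>\<^sub>F n in sequentially. ?s n x = (\<Sum>i\<in>S x. g i x)"
      by (auto simp: eventually_sequentially)
    then have "(\<lambda>n. ?s n x) \<longlonglongrightarrow> (\<Sum>i\<in>S x. g i x)" by (rule tendsto_eventually)
    then show ?thesis using True fin_iff by (simp add: limI)
  next
    case False
    then have inf: "\<not> (\<exists>n. \<forall>i. i \<in> S x \<longrightarrow> to_nat i < n)" using fin_iff by blast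
    show ?thesis by (subst if_not_P[OF inf]) (simp add: False)
  qed
  moreover have "(\<lambda>x. if \<exists>n. \<forall>i. i \<in> S x \<longrightarrow> to_nat i < n then lim (\<lambda>n. ?s n x) else 0) \<in> borel_measurable M"
    by measurable
  ultimately show ?thesis by simp
qed

lemma measurable_W_of [measurable]:
  "(\<lambda>p. W_of (fst p) (snd p)) \<in> borel_measurable (borel \<Otimes>\<^sub>M tree_algebra)"
  unfolding W_of_def W_sum_def
  by (intro borel_measurable_add borel_measurable_sum_random_set)
     (auto simp: alive_def dead_def death_time_def)

lemma measurable_subtree [measurable]: "subtree i \<in> tree_algebra \<rightarrow>\<^sub>M tree_algebra"
  unfolding subtree_def by (rule measurable_PiM_single') (auto simp: space_PiM)

section \<open>Independence of the root and the subtrees\<close>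

text \<open>The tree with the given mark at its root and the given subtrees at the children of the root.\<close>

definition graft :: "'m \<times> (nat \<Rightarrow> label \<Rightarrow> 'm) \<Rightarrow> label \<Rightarrow> 'm" where
  "graft p x = (if x = [] then fst p else snd p (last x) (butlast x))"

lemma graft_Nil [simp]: "graft p [] = fst p"
  and graft_snoc [simp]: "graft p (y @ [i]) = snd p i y"
  by (auto simp: graft_def)

lemma subtree_graft [simp]: "subtree i (graft p) = snd p i"
  by (auto simp: subtree_def fun_eq_iff)

lemma measurable_graft [measurable]:
  "graft \<in> P \<Otimes>\<^sub>M (\<Pi>\<^sub>M i\<in>UNIV. \<Pi>\<^sub>M x\<in>UNIV. P) \<rightarrow>\<^sub>M (\<Pi>\<^sub>M x\<in>UNIV. P)"
proof (rule measurable_PiM_single')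
  have "(\<lambda>z. z i y) \<in> (\<Pi>\<^sub>M i\<in>UNIV. \<Pi>\<^sub>M x\<in>UNIV. P) \<rightarrow>\<^sub>M P" for i :: nat and y :: label
    by (rule measurable_compose[where f="\<lambda>z. z i" and g="\<lambda>z. z y", OF measurable_component_singleton measurable_component_singleton]) auto
  note [measurable] = measurable_compose[OF measurable_snd this]
  show "(\<lambda>p. graft p x) \<in> P \<Otimes>\<^sub>M (\<Pi>\<^sub>M i\<in>UNIV. \<Pi>\<^sub>M x\<in>UNIV. P) \<rightarrow>\<^sub>M P" for x
    by (cases x rule: label_cases) (simp_all, measurable)
  then show "graft \<in> space (P \<Otimes>\<^sub>M (\<Pi>\<^sub>M i\<in>UNIV. \<Pi>\<^sub>M x\<in>UNIV. P)) \<rightarrow> (\<Pi>\<^sub>E i\<in>UNIV. space P)"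
    by (auto dest: measurable_space)
qed

text \<open>
  This is the branching property: independent copies of marks at all labels amount to a root mark
  together with an independent sequence of independent copies of the whole family. It suffices to
  compare both laws on cylinders over a finite set \<open>J\<close> of labels. The preimage of such a cylinder
  under \<open>graft\<close> is the product of a condition on the root mark and, for each child \<open>i\<close> among
  the finitely many in \<open>K\<close>, a cylinder over the labels \<open>Jk i\<close> of the subtree at \<open>i\<close>.
\<close>

lemma distr_graft:
  fixes P :: "'m measure"
  assumes "prob_space P"
  defines "T \<equiv> (\<Pi>\<^sub>M x\<in>(UNIV :: label set). P)"
  shows "distr (P \<Otimes>\<^sub>M (\<Pi>\<^sub>M i\<in>UNIV. T)) T graft = T"
proof -
  interpret P: prob_space P by fact
  interpret T: product_prob_space "\<lambda>_. P" "UNIV :: label set" by unfold_locales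
  interpret TT: product_prob_space "\<lambda>_. T" "UNIV :: nat set"
    unfolding T_def by unfold_locales
  let ?D = "P \<Otimes>\<^sub>M (\<Pi>\<^sub>M i\<in>(UNIV :: nat set). T)"
  have [measurable]: "graft \<in> ?D \<rightarrow>\<^sub>M T" unfolding T_def by measurable
  show ?thesis unfolding T_def
  proof (rule T.PiM_eq, unfold T_def[symmetric])
    fix J :: "label set" and F
    assume J: "finite J" and F: "\<And>j. j \<in> J \<Longrightarrow> F j \<in> sets P"
    define K where "K = last ` (J - {[]})"
    define Jk where "Jk i = (\<lambda>x. butlast x) ` {x \<in> J. x \<noteq> [] \<and> last x = i}" for i
    define F\<^sub>0 where "F\<^sub>0 = (if [] \<in> J then F [] else space P)"
    define B where "B i = prod_emb UNIV (\<lambda>_. P) (Jk i) (\<Pi>\<^sub>E y\<in>Jk i. F (y @ [i]))" for i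
    have Jk_iff: "y \<in> Jk i \<longleftrightarrow> y @ [i] \<in> J" for y i
      by (force simp: Jk_def image_iff)
    have fin: "finite K" "finite (Jk i)" for i
      using J by (auto simp: K_def Jk_def)
    have K_iff: "i \<in> K \<longleftrightarrow> (\<exists>y. y @ [i] \<in> J)" for i
    proof
      assume "i \<in> K"
      then obtain x where "x \<in> J" "x \<noteq> []" "i = last x" by (auto simp: K_def)
      then show "\<exists>y. y @ [i] \<in> J" by (intro exI[of _ "butlast x"]) simp
    qed (force simp: K_def image_iff)
    have B_sets: "B i \<in> sets T" for i
      unfolding B_def T_def by (rule sets_PiM_I) (auto simp: fin Jk_iff F)
    have F0: "F\<^sub>0 \<in> sets P" using F by (auto simp: F\<^sub>0_def)
    have "graft -` prod_emb UNIV (\<lambda>_. P) J (Pi\<^sub>E J F) \<inter> space ?D =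
        F\<^sub>0 \<times> prod_emb UNIV (\<lambda>_. T) K (Pi\<^sub>E K B)"
    proof (intro set_eqI iffI)
      fix p assume p: "p \<in> graft -` prod_emb UNIV (\<lambda>_. P) J (Pi\<^sub>E J F) \<inter> space ?D"
      then have in_F: "graft p x \<in> F x" if "x \<in> J" for x
        using that by (auto simp: prod_emb_iff PiE_iff)
      have sp: "fst p \<in> space P" "snd p i \<in> space T" for i
        using p by (auto simp: space_pair_measure space_PiM PiE_iff)
      have "fst p \<in> F\<^sub>0" using in_F[of "[]"] sp by (auto simp: F\<^sub>0_def)
      moreover have "snd p i \<in> B i" for i
        using in_F[of "_ @ [i]"] sp(2)[of i] by (auto simp: B_def prod_emb_iff PiE_iff Jk_iff T_def space_PiM)
      ultimately show "p \<in> F\<^sub>0 \<times> prod_emb UNIV (\<lambda>_. T) K (Pi\<^sub>E K B)"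
        using sp by (auto simp: mem_Times_iff prod_emb_iff PiE_iff)
    next
      fix p assume p: "p \<in> F\<^sub>0 \<times> prod_emb UNIV (\<lambda>_. T) K (Pi\<^sub>E K B)"
      then have f: "fst p \<in> F\<^sub>0" and "\<And>i. i \<in> K \<Longrightarrow> snd p i \<in> B i" and T: "\<And>i. snd p i \<in> space T"
        by (auto simp: prod_emb_iff PiE_iff)
      then have s: "snd p i y \<in> F (y @ [i])" if "y @ [i] \<in> J" for y i
        using that K_iff[of i] by (auto simp: B_def prod_emb_iff PiE_iff Jk_iff)
      have D: "p \<in> space ?D"
        using f T F0[THEN sets.sets_into_space] by (auto simp: space_pair_measure space_PiM mem_Times_iff)
      have "graft p x \<in> F x" if "x \<in> J" for x
        using that f s by (cases x rule: label_cases) (auto simp: F\<^sub>0_def)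
      moreover have "graft p \<in> space T"
        using measurable_space[OF \<open>graft \<in> ?D \<rightarrow>\<^sub>M T\<close> D] .
      ultimately show "p \<in> graft -` prod_emb UNIV (\<lambda>_. P) J (Pi\<^sub>E J F) \<inter> space ?D"
        using D by (auto simp: prod_emb_iff PiE_iff T_def space_PiM)
    qed
    moreover have "prod_emb UNIV (\<lambda>_. P) J (Pi\<^sub>E J F) \<in> sets T"
      unfolding T_def by (rule sets_PiM_I) (auto simp: J F)
    ultimately have "emeasure (distr ?D T graft) (prod_emb UNIV (\<lambda>_. P) J (Pi\<^sub>E J F)) =
        emeasure ?D (F\<^sub>0 \<times> prod_emb UNIV (\<lambda>_. T) K (Pi\<^sub>E K B))"
      by (subst emeasure_distr) auto
    also have "\<dots> = emeasure P F\<^sub>0 * emeasure (\<Pi>\<^sub>M i\<in>UNIV. T) (prod_emb UNIV (\<lambda>_. T) K (Pi\<^sub>E K B))"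
      by (intro TT.P.emeasure_pair_measure_Times F0 sets_PiM_I) (auto simp: fin B_sets)
    also have "emeasure (\<Pi>\<^sub>M i\<in>UNIV. T) (prod_emb UNIV (\<lambda>_. T) K (Pi\<^sub>E K B)) = (\<Prod>i\<in>K. emeasure T (B i))"
      by (rule TT.emeasure_PiM_emb) (auto simp: fin B_sets)
    also have "\<dots> = (\<Prod>i\<in>K. \<Prod>y\<in>Jk i. emeasure P (F (y @ [i])))"
      unfolding B_def T_def
      by (intro prod.cong refl T.emeasure_PiM_emb) (auto simp: fin Jk_iff F)
    also have "\<dots> = (\<Prod>(i, y)\<in>Sigma K Jk. emeasure P (F (y @ [i])))"
      by (rule prod.Sigma) (auto simp: fin)
    also have "\<dots> = (\<Prod>x\<in>J - {[]}. emeasure P (F x))"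
    proof (rule prod.reindex_bij_witness[of _ "\<lambda>x. (last x, butlast x)" "\<lambda>(i, y). y @ [i]"])
      show "(last x, butlast x) \<in> Sigma K Jk" if "x \<in> J - {[]}" for x
        using that by (cases x rule: label_cases) (auto simp: K_iff Jk_iff)
    qed (auto simp: Jk_iff)
    also have "emeasure P F\<^sub>0 * (\<Prod>x\<in>J - {[]}. emeasure P (F x)) = (\<Prod>x\<in>J. emeasure P (F x))"
      using J by (auto simp: F\<^sub>0_def prod.remove P.emeasure_space_1)
    finally show "emeasure (distr ?D T graft) (prod_emb UNIV (\<lambda>_. P) J (Pi\<^sub>E J F)) = (\<Prod>x\<in>J. emeasure P (F x))" .
  qed simp
qed

lemma integral_PiM_prod_components:
  fixes f :: "'i \<Rightarrow> 'x \<Rightarrow> complex"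
  assumes T: "prob_space T" and I: "finite I" and f: "\<And>i. i \<in> I \<Longrightarrow> integrable T (f i)"
  shows "(CLINT y|(\<Pi>\<^sub>M i\<in>UNIV. T). (\<Prod>i\<in>I. f i (y i))) = (\<Prod>i\<in>I. CLINT x|T. f i x)"
proof -
  interpret T: prob_space T by fact
  interpret TT: product_prob_space "\<lambda>_. T" UNIV by unfold_locales
  have [measurable]: "f i \<in> borel_measurable T" if "i \<in> I" for i using f[OF that] by auto
  have "(CLINT y|(\<Pi>\<^sub>M i\<in>UNIV. T). (\<Prod>i\<in>I. f i (y i))) =
      (CLINT y|(\<Pi>\<^sub>M i\<in>UNIV. T). (\<Prod>i\<in>I. f i (restrict y I i)))"
    by (intro Bochner_Integration.integral_cong prod.cong) auto
  also have "\<dots> = (CLINT y|distr (\<Pi>\<^sub>M i\<in>UNIV. T) (\<Pi>\<^sub>M i\<in>I. T) (\<lambda>y. restrict y I). (\<Prod>i\<in>I. f i (y i)))"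
    by (rule integral_distr[OF measurable_restrict_subset, symmetric]) (auto intro!: borel_measurable_prod)
  also have "\<dots> = (CLINT y|(\<Pi>\<^sub>M i\<in>I. T). (\<Prod>i\<in>I. f i (y i)))"
    by (subst TT.distr_PiM_restrict_finite) (auto simp: I)
  also have "\<dots> = (\<Prod>i\<in>I. CLINT x|T. f i x)"
    by (rule TT.product_integral_prod[OF I f])
  finally show ?thesis .
qed

section \<open>Truncation at a generation\<close>

text \<open>
  \<open>Z n\<close> is the integrand of the characteristic function of \<open>W\<close>, restricted to realizations that stay
  below generation \<open>n\<close>; \<open>Z_lim\<close> is its limit, which ignores realizations that have entered
  infinitely many generations.
\<close>

definition Z :: "nat \<Rightarrow> real \<Rightarrow> real \<Rightarrow> (label \<Rightarrow> mark) \<Rightarrow> complex" where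
  "Z n t \<xi> X = (if confined n t X then iexp (\<xi> * W_of t X) else 0)"

definition Z_lim :: "real \<Rightarrow> real \<Rightarrow> (label \<Rightarrow> mark) \<Rightarrow> complex" where
  "Z_lim t \<xi> X = (if \<exists>n. confined n t X then iexp (\<xi> * W_of t X) else 0)"

lemma norm_Z_le_1: "norm (Z n t \<xi> X) \<le> 1"
  and norm_Z_lim_le_1: "norm (Z_lim t \<xi> X) \<le> 1"
  by (auto simp: Z_def Z_lim_def)

lemma measurable_Z [measurable]:
  "(\<lambda>(p, X). Z n (fst p) (snd p) X) \<in> borel_measurable ((borel \<Otimes>\<^sub>M borel) \<Otimes>\<^sub>M tree_algebra)"
proof -
  let ?M = "(borel \<Otimes>\<^sub>M borel) \<Otimes>\<^sub>M tree_algebra :: ((real \<times> real) \<times> (label \<Rightarrow> mark)) measure"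
  have [measurable]: "Measurable.pred ?M (\<lambda>q. confined n (fst (fst q)) (snd q))"
    using measurable_compose[OF _ measurable_confined, of "\<lambda>q. (fst (fst q), snd q)" ?M n] by simp
  have [measurable]: "(\<lambda>q. W_of (fst (fst q)) (snd q)) \<in> borel_measurable ?M"
    using measurable_compose[OF _ measurable_W_of, of "\<lambda>q. (fst (fst q), snd q)" ?M] by simp
  show ?thesis unfolding Z_def case_prod_beta by measurable
qed

lemma Z_tendsto_Z_lim: "(\<lambda>n. Z n t \<xi> X) \<longlonglongrightarrow> Z_lim t \<xi> X"
proof (rule tendsto_eventually, cases "\<exists>n. confined n t X")
  case True
  then obtain m where "confined m t X" by blast
  then show "\<forall>\<^sub>F n in sequentially. Z n t \<xi> X = Z_lim t \<xi> X"
    by (auto simp: eventually_sequentially Z_def Z_lim_def intro!: exI[of _ m] dest: confined_mono)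
qed (simp add: Z_def Z_lim_def)

text \<open>
  When the root dies at a time \<open>e \<le> t\<close>, then \<open>W\<close> at time \<open>t\<close> is the root's \<open>C\<close> plus the sum over the
  children \<open>i\<close> of \<open>A i\<close> times the value of \<open>W\<close> at time \<open>t - e\<close> in the subtree of \<open>i\<close>. The exponential
  makes a product of this sum and transfers the factor \<open>A i\<close> to the frequency \<open>\<xi>\<close>.
\<close>

lemma Z_branching:
  assumes e: "\<And>x. 0 \<le> mark_E X x" and t: "0 \<le> t" and a: "\<And>i. 0 < mark_A X [] i"
  shows "Z (Suc n) t \<xi> X =
    (if mark_E X [] \<le> t
     then iexp (\<xi> * mark_C X []) *
       (\<Prod>i<mark_N X []. Z n (t - mark_E X []) (mark_A X [] i * \<xi>) (subtree i X))
     else iexp (\<xi> * mark_R X []))"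
proof (cases "mark_E X [] \<le> t")
  case False
  then show ?thesis
    using confined_before_first_split[of X t n] W_of_before_first_split[of X t] e t by (simp add: Z_def)
next
  case True
  show ?thesis
  proof (cases "confined (Suc n) t X")
    case c: True
    then have c': "confined n (t - mark_E X []) (subtree i X)" if "i < mark_N X []" for i
      using that by (simp add: confined_Suc)
    have W: "W_of t X = mark_C X [] +
        (\<Sum>i<mark_N X []. mark_A X [] i * W_of (t - mark_E X []) (subtree i X))"
      by (rule W_of_after_first_split[OF e True c' a])
    have "iexp (\<xi> * W_of t X) = iexp (\<xi> * mark_C X []) *
        (\<Prod>i<mark_N X []. iexp ((mark_A X [] i * \<xi>) * W_of (t - mark_E X []) (subtree i X)))"
      unfolding W
      by (simp add: exp_sum[symmetric] exp_add[symmetric] sum_distrib_left distrib_left algebra_simps)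
    then show ?thesis using True c c' by (simp add: Z_def)
  next
    case False
    then obtain i where "i < mark_N X []" "\<not> confined n (t - mark_E X []) (subtree i X)"
      by (auto simp: confined_Suc)
    then have "(\<Prod>i<mark_N X []. Z n (t - mark_E X []) (mark_A X [] i * \<xi>) (subtree i X)) = 0"
      by (auto simp: Z_def intro!: prod_zero)
    then show ?thesis using True False by (simp add: Z_def)
  qed
qed

text \<open>
  All expectations are computed on the canonical space, where a realization is the family of its
  marks: \<open>P\<close> is the law of one mark and \<open>T\<close> the law of the independent family.
\<close>

locale branching_law = nu: real_distribution \<nu> + kappa: prob_space \<kappa>
  for \<nu> :: "real measure" and \<kappa> :: "(nat \<times> real \<times> (nat \<Rightarrow> real)) measure" +
  assumes sets_kappa [measurable_cong]: "sets \<kappa> = sets mark_space"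
begin

definition P :: "mark measure" where
  "P = density lborel (exponential_density 1) \<Otimes>\<^sub>M \<nu> \<Otimes>\<^sub>M \<kappa>"

definition T :: "(label \<Rightarrow> mark) measure" where
  "T = (\<Pi>\<^sub>M x\<in>UNIV. P)"

abbreviation Q :: "(real \<Rightarrow> complex) \<Rightarrow> real \<Rightarrow> complex" where
  "Q \<equiv> Q_hat \<kappa> fst (\<lambda>v. fst (snd v)) (\<lambda>v. snd (snd v))"

definition G :: "nat \<Rightarrow> real \<Rightarrow> real \<Rightarrow> complex" where
  "G n t \<xi> = (CLINT X|T. Z n t \<xi> X)"

definition G_lim :: "real \<Rightarrow> real \<Rightarrow> complex" where
  "G_lim t \<xi> = (CLINT X|T. Z_lim t \<xi> X)"

lemma sets_P [measurable_cong]: "sets P = sets mark_algebra"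
  unfolding P_def by (intro sets_pair_measure_cong) (auto simp: sets_kappa)

lemma sets_T [measurable_cong]: "sets T = sets tree_algebra"
  unfolding T_def by (intro sets_PiM_cong sets_P refl)

lemma space_T: "space T = space tree_algebra"
  by (rule sets_eq_imp_space_eq[OF sets_T])

sublocale ex: prob_space "density lborel (exponential_density 1)"
  by (rule prob_space_exponential_density) simp

sublocale nk: pair_prob_space \<nu> \<kappa> ..

sublocale enk: pair_prob_space "density lborel (exponential_density 1)" "\<nu> \<Otimes>\<^sub>M \<kappa>" ..

sublocale P: prob_space P
  unfolding P_def by (rule enk.P.prob_space_axioms)

sublocale T: product_prob_space "\<lambda>_. P" "UNIV :: label set"
  by unfold_locales

sublocale T: prob_space T
  unfolding T_def by unfold_locales

sublocale TT: product_prob_space "\<lambda>_. T" "UNIV :: nat set"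
  by unfold_locales

sublocale PTT: pair_prob_space P "\<Pi>\<^sub>M i\<in>(UNIV :: nat set). T" ..

lemma AE_lifetimes_nonneg: "AE X in T. \<forall>x. 0 \<le> mark_E X x"
proof -
  have "AE e in density lborel (exponential_density 1). 0 \<le> e"
    by (subst AE_density) (auto simp: exponential_density_def)
  then have "AE p in P. 0 \<le> fst p"
    unfolding P_def by (intro enk.AE_pair_measure, measurable)
  then have "AE X in T. 0 \<le> mark_E X x" for x
    unfolding T_def by (intro AE_PiM_component) (auto intro: P.prob_space_axioms)
  then show ?thesis by (simp add: AE_all_countable)
qed

lemma Z_measurable [measurable]: "Z n t \<xi> \<in> borel_measurable T"
  using measurable_compose[OF _ measurable_Z, of "\<lambda>X. ((t, \<xi>), X)" T n] by simp

lemma Z_integrable: "integrable T (Z n t \<xi>)"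
  by (rule T.integrable_const_bound[of _ 1]) (auto simp: norm_Z_le_1)

lemma Z_lim_measurable [measurable]: "Z_lim t \<xi> \<in> borel_measurable T"
  by (rule borel_measurable_LIMSEQ_metric[OF _ Z_tendsto_Z_lim]) auto

lemma G_measurable [measurable]: "(\<lambda>p. G n (fst p) (snd p)) \<in> borel_measurable (borel \<Otimes>\<^sub>M borel)"
  unfolding G_def by (rule T.borel_measurable_lebesgue_integral) measurable

lemma G_tendsto_G_lim: "(\<lambda>n. G n t \<xi>) \<longlonglongrightarrow> G_lim t \<xi>"
  unfolding G_def G_lim_def
  by (rule integral_dominated_convergence[where w="\<lambda>_. 1"]) (auto simp: norm_Z_le_1 Z_tendsto_Z_lim)

lemma G_lim_measurable [measurable]: "(\<lambda>p. G_lim (fst p) (snd p)) \<in> borel_measurable (borel \<Otimes>\<^sub>M borel)"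
  by (rule borel_measurable_LIMSEQ_metric[OF G_measurable G_tendsto_G_lim])

lemma norm_G_le_1: "norm (G n t \<xi>) \<le> 1"
proof -
  have "norm (G n t \<xi>) \<le> (LINT X|T. norm (Z n t \<xi> X))" unfolding G_def by (rule integral_norm_bound)
  also have "\<dots> \<le> 1" by (rule T.integral_le_const) (auto simp: norm_Z_le_1 Z_integrable)
  finally show ?thesis .
qed

lemma norm_G_lim_le_1: "norm (G_lim t \<xi>) \<le> 1"
  by (rule LIMSEQ_le_const2[OF tendsto_norm[OF G_tendsto_G_lim]]) (auto simp: norm_G_le_1)

lemma Q_integrand_measurable:
  assumes [measurable]: "\<psi> \<in> borel_measurable borel"
  shows "(\<lambda>v. iexp (\<xi> * fst (snd v)) * (\<Prod>k<fst v. \<psi> (snd (snd v) k * \<xi>))) \<in> borel_measurable \<kappa>"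
proof -
  have "(\<lambda>v. \<Prod>k<fst v. \<psi> (snd (snd v) k * \<xi>)) \<in> borel_measurable \<kappa>"
    by (rule measurable_compose_countable[where g=fst]) measurable
  then show ?thesis by measurable
qed

lemma Q_integrand_norm:
  assumes "\<And>x. norm (\<psi> x) \<le> 1"
  shows "norm (iexp (\<xi> * c) * (\<Prod>k<n. \<psi> (a k * \<xi>))) \<le> 1"
  by (auto simp: norm_mult prod_norm[symmetric] intro!: prod_le_1 assms)

lemma Q_integrable:
  assumes "\<psi> \<in> borel_measurable borel" "\<And>x. norm (\<psi> x) \<le> 1"
  shows "integrable \<kappa> (\<lambda>v. iexp (\<xi> * fst (snd v)) * (\<Prod>k<fst v. \<psi> (snd (snd v) k * \<xi>)))"
  by (rule kappa.integrable_const_bound[of _ 1])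
     (intro AE_I2 Q_integrand_norm[OF assms(2)] Q_integrand_measurable[OF assms(1)])+

lemma norm_Q_le_1:
  assumes "\<psi> \<in> borel_measurable borel" "\<And>x. norm (\<psi> x) \<le> 1"
  shows "norm (Q \<psi> \<xi>) \<le> 1"
proof -
  have "norm (Q \<psi> \<xi>) \<le> (LINT v|\<kappa>. norm (iexp (\<xi> * fst (snd v)) * (\<Prod>k<fst v. \<psi> (snd (snd v) k * \<xi>))))"
    unfolding Q_hat_def by (rule integral_norm_bound)
  also have "\<dots> \<le> 1"
    by (rule kappa.integral_le_const)
       (intro Q_integrable[OF assms] Q_integrand_norm[OF assms(2)] AE_I2 integrable_norm)+
  finally show ?thesis .
qed

text \<open>
  The number of factors in each product is finite, so pointwise convergence passes through the
  product and then, by domination, through the expectation.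
\<close>

lemma Q_tendsto:
  assumes meas: "\<And>n. \<psi> n \<in> borel_measurable borel" "\<psi>' \<in> borel_measurable borel"
    and bdd: "\<And>n x. norm (\<psi> n x) \<le> 1" and lim: "\<And>x. (\<lambda>n. \<psi> n x) \<longlonglongrightarrow> \<psi>' x"
  shows "(\<lambda>n. Q (\<psi> n) \<xi>) \<longlonglongrightarrow> Q \<psi>' \<xi>"
  unfolding Q_hat_def
proof (rule integral_dominated_convergence[where w="\<lambda>_. 1"])
  show "AE v in \<kappa>. (\<lambda>n. iexp (\<xi> * fst (snd v)) * (\<Prod>k<fst v. \<psi> n (snd (snd v) k * \<xi>)))
      \<longlonglongrightarrow> iexp (\<xi> * fst (snd v)) * (\<Prod>k<fst v. \<psi>' (snd (snd v) k * \<xi>))"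
    by (intro AE_I2 tendsto_intros lim)
qed (intro Q_integrand_measurable meas Q_integrand_norm bdd AE_I2 kappa.integrable_const)+

lemma Q_G_measurable [measurable]: "(\<lambda>u. Q (G n u) \<xi>) \<in> borel_measurable borel"
proof -
  have [measurable]: "(\<lambda>q. G n (fst q) (snd (snd (snd q)) k * \<xi>)) \<in> borel_measurable (borel \<Otimes>\<^sub>M \<kappa>)" for k
    using measurable_compose[OF _ G_measurable, of "\<lambda>q. (fst q, snd (snd (snd q)) k * \<xi>)" "borel \<Otimes>\<^sub>M \<kappa>" n]
    by simp
  have [measurable]: "(\<lambda>q. \<Prod>k<fst (snd q). G n (fst q) (snd (snd (snd q)) k * \<xi>)) \<in> borel_measurable (borel \<Otimes>\<^sub>M \<kappa>)"
    by (rule measurable_compose_countable[where g="\<lambda>q. fst (snd q)"]) measurable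
  show ?thesis
    unfolding Q_hat_def by (rule kappa.borel_measurable_lebesgue_integral) (simp add: case_prod_beta, measurable)
qed

lemma G_measurable2 [measurable]: "G n t \<in> borel_measurable borel"
  using measurable_compose[OF _ G_measurable, of "\<lambda>\<xi>. (t, \<xi>)" borel n] by simp

lemma G_lim_measurable2 [measurable]: "G_lim t \<in> borel_measurable borel"
  using measurable_compose[OF _ G_lim_measurable, of "\<lambda>\<xi>. (t, \<xi>)" borel] by simp

lemma Q_G_tendsto: "(\<lambda>n. Q (G n u) \<xi>) \<longlonglongrightarrow> Q (G_lim u) \<xi>"
  by (rule Q_tendsto) (auto simp: norm_G_le_1 G_tendsto_G_lim)

lemma Q_G_lim_measurable [measurable]: "(\<lambda>u. Q (G_lim u) \<xi>) \<in> borel_measurable borel"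
  by (rule borel_measurable_LIMSEQ_metric[OF _ Q_G_tendsto]) measurable

end

section \<open>The backward equation\<close>

lemma (in pair_prob_space) integral_fst_only:
  fixes f :: "'a \<Rightarrow> complex"
  assumes [measurable]: "f \<in> borel_measurable M1"
  shows "(CLINT p|(M1 \<Otimes>\<^sub>M M2). f (fst p)) = (CLINT x|M1. f x)"
proof -
  have "distr (M1 \<Otimes>\<^sub>M M2) M1 fst = M1"
  proof (rule measure_eqI)
    fix A assume "A \<in> sets (distr (M1 \<Otimes>\<^sub>M M2) M1 fst)"
    then have A: "A \<in> sets M1" by simp
    have "fst -` A \<inter> space (M1 \<Otimes>\<^sub>M M2) = A \<times> space M2"
      using sets.sets_into_space[OF A] by (auto simp: space_pair_measure)
    then show "emeasure (distr (M1 \<Otimes>\<^sub>M M2) M1 fst) A = emeasure M1 A"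
      using A by (simp add: emeasure_distr M2.emeasure_pair_measure_Times M2.emeasure_space_1)
  qed simp
  then show ?thesis
    using integral_distr[of fst "M1 \<Otimes>\<^sub>M M2" M1 f] by simp
qed

lemma (in pair_prob_space) integral_snd_only:
  fixes f :: "'b \<Rightarrow> complex"
  assumes [measurable]: "f \<in> borel_measurable M2"
  shows "(CLINT p|(M1 \<Otimes>\<^sub>M M2). f (snd p)) = (CLINT x|M2. f x)"
proof -
  have "distr (M1 \<Otimes>\<^sub>M M2) M2 snd = M2"
  proof (rule measure_eqI)
    fix A assume "A \<in> sets (distr (M1 \<Otimes>\<^sub>M M2) M2 snd)"
    then have A: "A \<in> sets M2" by simp
    have "snd -` A \<inter> space (M1 \<Otimes>\<^sub>M M2) = space M1 \<times> A"
      using sets.sets_into_space[OF A] by (auto simp: space_pair_measure)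
    then show "emeasure (distr (M1 \<Otimes>\<^sub>M M2) M2 snd) A = emeasure M2 A"
      using A by (simp add: emeasure_distr M2.emeasure_pair_measure_Times M1.emeasure_space_1)
  qed simp
  then show ?thesis
    using integral_distr[of snd "M1 \<Otimes>\<^sub>M M2" M2 f] by simp
qed

text \<open>
  Conditioning on an exponential waiting time \<open>e\<close>: with probability \<open>exp (-t)\<close> nothing happens before
  \<open>t\<close>, and otherwise \<open>u = t - e\<close> is the remaining time.
\<close>

lemma integral_exponential_first_event:
  fixes q :: "real \<Rightarrow> complex"
  assumes [measurable]: "q \<in> borel_measurable borel" and t: "0 \<le> t"
    and q: "\<And>u. norm (q u) \<le> 1"
  shows "(CLINT e|density lborel (exponential_density 1). if e \<le> t then q (t - e) else c) =
    exp (-t) *\<^sub>R (c + (LBINT u:{0..t}. exp u *\<^sub>R q u))"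
proof -
  interpret ex: prob_space "density lborel (exponential_density 1)"
    by (rule prob_space_exponential_density) simp
  let ?D = "density lborel (exponential_density 1)"
  have "(CLINT e|?D. if e \<le> t then q (t - e) else c) =
      (CLINT e|?D. indicator {..t} e *\<^sub>R q (t - e) + indicator {t<..} e *\<^sub>R c)"
    by (intro Bochner_Integration.integral_cong) (auto simp: indicator_def)
  also have "\<dots> = (CLINT e|?D. indicator {..t} e *\<^sub>R q (t - e)) + (CLINT e|?D. indicator {t<..} e *\<^sub>R c)"
  proof (rule Bochner_Integration.integral_add)
    show "integrable ?D (\<lambda>e. indicator {..t} e *\<^sub>R q (t - e))"
      by (rule ex.integrable_const_bound[of _ 1]) (auto simp: indicator_def q)
  qed (auto intro!: integrable_scaleR_left simp: ex.emeasure_eq_measure)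
  also have "(CLINT e|?D. indicator {t<..} e *\<^sub>R c) = exp (-t) *\<^sub>R c"
  proof -
    have "distributed ?D lborel (\<lambda>x. x) (exponential_density 1)"
      by (auto simp: distributed_def distr_id2)
    from ex.exponential_distributedD_gt[OF this t] have "measure ?D {t<..} = exp (-t)"
      by (simp add: greaterThan_def)
    then show ?thesis by (simp add: ex.emeasure_eq_measure)
  qed
  also have "(CLINT e|?D. indicator {..t} e *\<^sub>R q (t - e)) = exp (-t) *\<^sub>R (LBINT u:{0..t}. exp u *\<^sub>R q u)"
  proof -
    have "(CLINT e|?D. indicator {..t} e *\<^sub>R q (t - e)) =
        (CLINT e|lborel. exponential_density 1 e *\<^sub>R indicator {..t} e *\<^sub>R q (t - e))"
      by (subst integral_density) (auto simp: exponential_density_def)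
    also have "\<dots> = (CLINT u|lborel. exponential_density 1 (t - u) *\<^sub>R indicator {..t} (t - u) *\<^sub>R q u)"
      by (subst lborel_integral_real_affine[where c="-1" and t=t]) auto
    also have "\<dots> = (CLINT u|lborel. exp (-t) *\<^sub>R indicator {0..t} u *\<^sub>R exp u *\<^sub>R q u)"
      by (intro Bochner_Integration.integral_cong)
         (auto simp: indicator_def exponential_density_def exp_diff exp_minus field_simps)
    also have "\<dots> = exp (-t) *\<^sub>R (CLINT u|lborel. indicator {0..t} u *\<^sub>R exp u *\<^sub>R q u)"
      by (simp only: scaleR_conv_of_real integral_mult_right_zero)
    finally show ?thesis unfolding set_lebesgue_integral_def .
  qed
  finally show ?thesis by (simp add: algebra_simps)
qed

context branching_law
begin

lemma integral_P: "integral\<^sup>L P f = (CLINT e|density lborel (exponential_density 1). CLINT v|(\<nu> \<Otimes>\<^sub>M \<kappa>). f (e, v))"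
  if "integrable P f" for f :: "mark \<Rightarrow> complex"
  using enk.integral_fst'[OF that[unfolded P_def]] unfolding P_def by simp

text \<open>
  Condition on the mark of the root. By the branching property the subtrees are independent copies
  of the tree, so the expectation of the product in \<open>Z_branching\<close> is a product of values of \<open>G n\<close>;
  averaging over \<open>N\<close>, \<open>C\<close> and the \<open>A k\<close> then yields the operator \<open>Q\<close>.
\<close>

lemma G_Suc:
  assumes t: "0 \<le> t"
  shows "G (Suc n) t \<xi> = exp (-t) *\<^sub>R (char \<nu> \<xi> + (LBINT u:{0..t}. exp u *\<^sub>R Q (G n u) \<xi>))"
proof -
  define h :: "mark \<times> (nat \<Rightarrow> label \<Rightarrow> mark) \<Rightarrow> complex" where
    "h = (\<lambda>((e, r, N, c, a), Y). if e \<le> t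
       then iexp (\<xi> * c) * (\<Prod>i<N. Z n (t - e) (a i * \<xi>) (Y i)) else iexp (\<xi> * r))"
  let ?PY = "P \<Otimes>\<^sub>M (\<Pi>\<^sub>M i\<in>(UNIV :: nat set). T)"
  have h_meas [measurable]: "h \<in> borel_measurable ?PY"
  proof -
    have [measurable]: "(\<lambda>p. snd (snd (snd (snd (fst p)))) i) \<in> borel_measurable ?PY" for i
      by (rule measurable_compose[OF _ measurable_vector(3)]) measurable
    have [measurable]: "(\<lambda>p. Z n (t - fst (fst p)) (snd (snd (snd (snd (fst p)))) i * \<xi>) (snd p i)) \<in> borel_measurable ?PY" for i
      using measurable_compose[OF _ measurable_Z,
          of "\<lambda>p. ((t - fst (fst p), snd (snd (snd (snd (fst p)))) i * \<xi>), snd p i)" ?PY n]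
      by simp
    have [measurable]: "(\<lambda>p. fst (snd (snd (fst p)))) \<in> ?PY \<rightarrow>\<^sub>M count_space UNIV"
      unfolding mark_space_def by measurable
    have [measurable]: "(\<lambda>p. \<Prod>i<fst (snd (snd (fst p))). Z n (t - fst (fst p)) (snd (snd (snd (snd (fst p)))) i * \<xi>) (snd p i))
        \<in> borel_measurable ?PY"
      by (rule measurable_compose_countable[where g="\<lambda>p. fst (snd (snd (fst p)))"]) measurable
    show ?thesis unfolding h_def case_prod_beta by measurable
  qed
  have h_bdd: "norm (h p) \<le> 1" for p
    by (auto simp: h_def case_prod_beta norm_mult prod_norm[symmetric] intro!: prod_le_1 norm_Z_le_1)
  have inner: "(CLINT Y|(\<Pi>\<^sub>M i\<in>UNIV. T). (\<Prod>i<N. Z n s (a i * \<xi>) (Y i))) = (\<Prod>i<N. G n s (a i * \<xi>))"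
    for N s and a :: "nat \<Rightarrow> real"
    unfolding G_def
    by (rule integral_PiM_prod_components[where f="\<lambda>i. Z n s (a i * \<xi>)"])
       (auto simp: T.prob_space_axioms Z_integrable)
  have h_int: "integrable ?PY h"
    by (rule PTT.integrable_const_bound[of _ 1]) (auto simp: h_bdd)
  have graft_meas: "graft \<in> ?PY \<rightarrow>\<^sub>M T" unfolding T_def by measurable
  have "AE X in T. Z (Suc n) t \<xi> X = h (X [], \<lambda>i. subtree i X)"
    using AE_lifetimes_nonneg AE_space
  proof eventually_elim
    case (elim X)
    then have "0 < mark_A X [] i" for i by (intro mark_A_pos) (simp add: space_T)
    then show ?case using elim(1) t
      by (simp add: Z_branching[of X] h_def case_prod_beta)
  qed
  moreover have sub_meas: "(\<lambda>X. (X [], \<lambda>i. subtree i X)) \<in> T \<rightarrow>\<^sub>M ?PY"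
    by (intro measurable_Pair measurable_PiM_single') (auto simp: space_T intro: measurable_space[OF measurable_subtree])
  ultimately have "G (Suc n) t \<xi> = (CLINT X|T. h (X [], \<lambda>i. subtree i X))"
    unfolding G_def by (intro integral_cong_AE measurable_compose[OF sub_meas h_meas]) auto
  also have "\<dots> = (CLINT X|distr ?PY T graft. h (X [], \<lambda>i. subtree i X))"
    using distr_graft[OF P.prob_space_axioms] by (simp add: T_def)
  also have "\<dots> = (CLINT p|?PY. h p)"
    by (subst integral_distr[OF graft_meas measurable_compose[OF sub_meas h_meas]]) simp
  also have "\<dots> = (CLINT m|P. CLINT Y|(\<Pi>\<^sub>M i\<in>UNIV. T). h (m, Y))"
    by (rule PTT.integral_fst'[OF h_int, symmetric])
  also have h_eq: "(\<lambda>m. CLINT Y|(\<Pi>\<^sub>M i\<in>UNIV. T). h (m, Y)) =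
      (\<lambda>(e, r, N, c, a). if e \<le> t then iexp (\<xi> * c) * (\<Prod>i<N. G n (t - e) (a i * \<xi>)) else iexp (\<xi> * r))"
    by (auto simp: h_def fun_eq_iff inner TT.P.prob_space)
  also have "(CLINT m|P. (\<lambda>(e, r, N, c, a). if e \<le> t then iexp (\<xi> * c) * (\<Prod>i<N. G n (t - e) (a i * \<xi>)) else iexp (\<xi> * r)) m)
     = (CLINT e|density lborel (exponential_density 1). if e \<le> t then Q (G n (t - e)) \<xi> else char \<nu> \<xi>)"
  proof (subst integral_P, goal_cases)
    case 1
    have "integrable P (\<lambda>m. CLINT Y|(\<Pi>\<^sub>M i\<in>UNIV. T). h (m, Y))"
      by (rule PTT.integrable_fst'[OF h_int])
    then show ?case
      by (simp add: h_eq)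
  next
    case 2
    have "(CLINT v|(\<nu> \<Otimes>\<^sub>M \<kappa>). iexp (\<xi> * fst (snd (snd v))) * (\<Prod>i<fst (snd v). G n (t - e) (snd (snd (snd v)) i * \<xi>)))
        = Q (G n (t - e)) \<xi>" for e
      unfolding Q_hat_def
      by (rule nk.integral_snd_only) (rule Q_integrand_measurable, measurable)
    moreover have "(CLINT v|(\<nu> \<Otimes>\<^sub>M \<kappa>). iexp (\<xi> * fst v)) = char \<nu> \<xi>"
      unfolding char_def by (rule nk.integral_fst_only) simp
    ultimately show ?case
      by (intro Bochner_Integration.integral_cong) (auto simp: case_prod_beta')
  qed
  also have "\<dots> = exp (-t) *\<^sub>R (char \<nu> \<xi> + (LBINT u:{0..t}. exp u *\<^sub>R Q (G n u) \<xi>))"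
    by (rule integral_exponential_first_event)
       (auto simp: t intro!: norm_Q_le_1 norm_G_le_1)
  finally show ?thesis .
qed

text \<open>
  Passing to the limit in the truncation level turns the recursion into a fixed-point equation, so
  that \<open>G_lim\<close> solves the Cauchy problem regardless of explosion. Without explosion it is the
  characteristic function of \<open>W\<close>.
\<close>

lemma G_lim_mild:
  assumes t: "0 \<le> t"
  shows "G_lim t \<xi> = exp (-t) *\<^sub>R (char \<nu> \<xi> + (LBINT u:{0..t}. exp u *\<^sub>R Q (G_lim u) \<xi>))"
proof (rule LIMSEQ_unique)
  show "(\<lambda>n. G (Suc n) t \<xi>) \<longlonglongrightarrow> G_lim t \<xi>"
    by (rule LIMSEQ_Suc[OF G_tendsto_G_lim])
  have "(\<lambda>n. LBINT u:{0..t}. exp u *\<^sub>R Q (G n u) \<xi>) \<longlonglongrightarrow> (LBINT u:{0..t}. exp u *\<^sub>R Q (G_lim u) \<xi>)"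
    unfolding set_lebesgue_integral_def
  proof (rule integral_dominated_convergence[where w="\<lambda>u. indicator {0..t} u *\<^sub>R exp u"])
    show "integrable lborel (\<lambda>u. indicator {0..t} u *\<^sub>R exp u :: real)"
      using borel_integrable_atLeastAtMost'[of 0 t exp] by (simp add: set_integrable_def continuous_on_exp)
    show "AE u in lborel. (\<lambda>n. indicator {0..t} u *\<^sub>R exp u *\<^sub>R Q (G n u) \<xi>)
        \<longlonglongrightarrow> indicator {0..t} u *\<^sub>R exp u *\<^sub>R Q (G_lim u) \<xi>"
      by (intro AE_I2 tendsto_intros Q_G_tendsto)
    show "AE u in lborel. norm (indicator {0..t} u *\<^sub>R exp u *\<^sub>R Q (G n u) \<xi>) \<le> indicator {0..t} u *\<^sub>R exp u" for n
      using norm_Q_le_1[of "G n _" \<xi>] by (auto simp: indicator_def norm_G_le_1)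
  qed auto
  then show "(\<lambda>n. G (Suc n) t \<xi>) \<longlonglongrightarrow> exp (-t) *\<^sub>R (char \<nu> \<xi> + (LBINT u:{0..t}. exp u *\<^sub>R Q (G_lim u) \<xi>))"
    unfolding G_Suc[OF t] by (intro tendsto_intros)
qed

lemma G_lim_at_0: "G_lim 0 \<xi> = char \<nu> \<xi>"
proof -
  have "(LBINT u:{0..0}. exp u *\<^sub>R Q (G_lim u) \<xi>) = 0"
    unfolding set_lebesgue_integral_def
    by (rule integral_eq_zero_AE) (use AE_lborel_singleton[of "0::real"] in \<open>auto elim: eventually_mono\<close>)
  then show ?thesis using G_lim_mild[of 0 \<xi>] by simp
qed

lemma continuous_on_G_lim: "continuous_on {0..} (\<lambda>t. G_lim t \<xi>)"
  by (subst continuous_on_cong[OF refl G_lim_mild])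
     (auto intro!: continuous_on_duhamel norm_Q_le_1 norm_G_lim_le_1)

lemma continuous_on_Q_G_lim: "continuous_on {0..} (\<lambda>t. Q (G_lim t) \<xi>)"
  unfolding continuous_on_sequentially
proof (intro allI ballI impI, elim conjE)
  fix s :: "nat \<Rightarrow> real" and t
  assume t: "t \<in> {0..}" and s: "\<forall>n. s n \<in> {0..}" "s \<longlonglongrightarrow> t"
  have "(\<lambda>n. G_lim (s n) x) \<longlonglongrightarrow> G_lim t x" for x
    using continuous_on_G_lim[of x] t s unfolding continuous_on_sequentially by (auto simp: comp_def)
  then show "((\<lambda>t. Q (G_lim t) \<xi>) \<circ> s) \<longlonglongrightarrow> Q (G_lim t) \<xi>"
    unfolding comp_def by (intro Q_tendsto) (auto simp: norm_G_lim_le_1)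
qed

lemma G_lim_has_vector_derivative:
  assumes "0 \<le> t"
  shows "((\<lambda>s. G_lim s \<xi>) has_vector_derivative Q (G_lim t) \<xi> - G_lim t \<xi>) (at t within {0..})"
proof -
  have "((\<lambda>s. exp (-s) *\<^sub>R (char \<nu> \<xi> + (LBINT u:{0..s}. exp u *\<^sub>R Q (G_lim u) \<xi>)))
      has_vector_derivative Q (G_lim t) \<xi> - G_lim t \<xi>) (at t within {0..})"
    using has_vector_derivative_duhamel[where q="\<lambda>t. Q (G_lim t) \<xi>" and c="char \<nu> \<xi>",
        OF continuous_on_Q_G_lim assms]
    by (simp only: G_lim_mild[OF assms, symmetric])
  then show ?thesis
    by (rule has_vector_derivative_transform[rotated 2]) (use assms in \<open>auto simp: G_lim_mild\<close>)
qed

end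

section \<open>Absence of explosion\<close>

lemma power_convex_combination:
  fixes x y :: real
  assumes "0 \<le> x" "0 \<le> y" "0 < t" "t < 1"
  shows "((1 - t) * x + t * y) ^ n \<le> (1 - t) * x ^ n + t * y ^ n"
proof -
  have "convex_on {0::real..} (\<lambda>x. x ^ n)"
    using convex_power_odd[of n] convex_on_subset[OF convex_power_even[of n]] by (cases "even n") auto
  from convex_onD[OF this, of t x y] assms show ?thesis by simp
qed

context branching_law
begin

definition offspring_gf :: "real \<Rightarrow> real" where
  "offspring_gf s = (LINT v|\<kappa>. s ^ fst v)"

definition p_confined :: "nat \<Rightarrow> real \<Rightarrow> real" where
  "p_confined n t = T.prob {X \<in> space T. confined n t X}"

text \<open>The probability of non-explosion by time \<open>t\<close>.\<close>

definition p_regular :: "real \<Rightarrow> real" where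
  "p_regular t = T.prob {X \<in> space T. \<exists>n. confined n t X}"

lemma power_offspring_integrable: "s \<in> {0..1} \<Longrightarrow> integrable \<kappa> (\<lambda>v. s ^ fst v :: real)"
  by (rule kappa.integrable_const_bound[of _ 1]) (auto intro!: AE_I2 power_le_one)

lemma offspring_gf_1: "offspring_gf 1 = 1"
  by (simp add: offspring_gf_def kappa.prob_space)

lemma offspring_gf_measurable [measurable]: "offspring_gf \<in> borel_measurable borel"
  unfolding offspring_gf_def by (rule kappa.borel_measurable_lebesgue_integral) measurable

lemma offspring_gf_bounds: "s \<in> {0..1} \<Longrightarrow> offspring_gf s \<in> {0..1}"
  unfolding offspring_gf_def
  by (auto intro!: integral_nonneg_AE AE_I2 kappa.integral_le_const power_offspring_integrable power_le_one)

lemma offspring_gf_continuous: "continuous_on {0..1} offspring_gf"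
  unfolding continuous_on_sequentially
proof (intro allI ballI impI, elim conjE)
  fix x :: "nat \<Rightarrow> real" and a
  assume x: "\<forall>n. x n \<in> {0..1}" "x \<longlonglongrightarrow> a"
  show "(offspring_gf \<circ> x) \<longlonglongrightarrow> offspring_gf a"
    unfolding comp_def offspring_gf_def
  proof (rule integral_dominated_convergence[where w="\<lambda>_. 1"])
    show "AE v in \<kappa>. norm (x n ^ fst v) \<le> 1" for n
      using x(1) by (auto intro!: AE_I2 power_le_one simp: abs_of_nonneg power_abs)
  qed (auto intro!: AE_I2 tendsto_intros x(2))
qed

lemma offspring_gf_convex: "convex_on {0..1} offspring_gf"
proof (rule convex_onI)
  fix t x y :: real
  assume t: "0 < t" "t < 1" and xy: "x \<in> {0..1}" "y \<in> {0..1}"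
  have "(1 - t) *\<^sub>R x + t *\<^sub>R y \<in> {0..1}"
    by (rule convexD_alt[OF _ xy(1,2)]) (use t in auto)
  then have "offspring_gf ((1 - t) *\<^sub>R x + t *\<^sub>R y) \<le> (LINT v|\<kappa>. (1 - t) * x ^ fst v + t * y ^ fst v)"
    unfolding offspring_gf_def
    by (intro integral_mono Bochner_Integration.integrable_add integrable_mult_right power_offspring_integrable xy)
       (use power_convex_combination t xy in auto)
  also have "\<dots> = (1 - t) * offspring_gf x + t * offspring_gf y"
    unfolding offspring_gf_def using xy
    by (subst Bochner_Integration.integral_add) (auto intro!: power_offspring_integrable)
  finally show "offspring_gf ((1 - t) *\<^sub>R x + t *\<^sub>R y) \<le> (1 - t) * offspring_gf x + t * offspring_gf y" .
qed simp

lemma Q_0: "Q \<psi> 0 = (CLINT v|\<kappa>. \<psi> 0 ^ fst v)"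
  by (simp add: Q_hat_def)

lemma Q_of_real_0: "\<psi> 0 = of_real s \<Longrightarrow> Q \<psi> 0 = of_real (offspring_gf s)"
  unfolding Q_0 offspring_gf_def integral_complex_of_real[symmetric] by simp

lemma confined_event [measurable]: "Measurable.pred T (confined n t)"
  using measurable_compose[OF _ measurable_confined, of "\<lambda>X. (t, X)" T n] by simp

lemma G_0: "G n t 0 = of_real (p_confined n t)"
proof -
  have "G n t 0 = (CLINT X|T. of_real (indicator {X \<in> space T. confined n t X} X :: real))"
    unfolding G_def by (intro Bochner_Integration.integral_cong) (auto simp: Z_def)
  then show ?thesis
    unfolding integral_complex_of_real by (simp add: p_confined_def Int_absorb2 Collect_restrict)
qed

lemma G_lim_0: "G_lim t 0 = of_real (p_regular t)"
proof -
  have "G_lim t 0 = (CLINT X|T. of_real (indicator {X \<in> space T. \<exists>n. confined n t X} X :: real))"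
    unfolding G_lim_def by (intro Bochner_Integration.integral_cong) (auto simp: Z_lim_def)
  then show ?thesis
    unfolding integral_complex_of_real by (simp add: p_regular_def Int_absorb2 Collect_restrict)
qed

lemma Q_G_0: "Q (G n t) 0 = of_real (offspring_gf (p_confined n t))"
  and Q_G_lim_0: "Q (G_lim t) 0 = of_real (offspring_gf (p_regular t))"
  by (simp_all add: Q_of_real_0 G_0 G_lim_0)

lemma p_confined_tendsto: "(\<lambda>n. p_confined n t) \<longlonglongrightarrow> p_regular t"
  using G_tendsto_G_lim[of t 0] unfolding G_0 G_lim_0 by (simp add: tendsto_of_real_iff)

lemma p_confined_bounds: "0 \<le> p_confined n t \<and> p_confined n t \<le> 1"
  by (auto simp: p_confined_def)

lemma norm_G_le_p_confined: "norm (G n t \<xi>) \<le> p_confined n t"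
proof -
  have "norm (G n t \<xi>) \<le> (LINT X|T. norm (Z n t \<xi> X))" unfolding G_def by (rule integral_norm_bound)
  also have "\<dots> = (LINT X|T. indicator {X \<in> space T. confined n t X} X)"
    by (intro Bochner_Integration.integral_cong) (auto simp: Z_def)
  finally show ?thesis by (simp add: p_confined_def Int_absorb2 Collect_restrict)
qed

lemma p_regular_antimono: "s \<le> t \<Longrightarrow> p_regular t \<le> p_regular s"
  unfolding p_regular_def by (intro T.finite_measure_mono) (auto dest: confined_antimono_time)

text \<open>
  At \<open>\<xi> = 0\<close> the Cauchy problem solved by \<open>G_lim\<close> is the scalar equation \<open>w' = f w - w\<close>, \<open>w 0 = 1\<close>,
  for the probability \<open>w\<close> of non-explosion and the generating function \<open>f\<close> of the offspring number.
\<close>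

lemma p_regular_eq_1:
  assumes diverges: "\<forall>\<^sub>F \<epsilon> in at_right (0::real).
      (\<integral>\<^sup>+ s\<in>{1 - \<epsilon>..1}. ennreal (1 / (s - offspring_gf s)) \<partial>lborel) = \<infinity>"
    and t: "0 \<le> t"
  shows "p_regular t = 1"
proof (rule osgood_constant[where f=offspring_gf and w=p_regular, OF _ _ _ _ diverges _ _ _ _ t])
  show "p_regular 0 = 1"
    using G_lim_at_0[of 0] by (simp add: G_lim_0 nu.char_zero)
  show "(p_regular has_real_derivative offspring_gf (p_regular s) - p_regular s) (at s within {0..})" if "0 \<le> s" for s
    using bounded_linear.has_vector_derivative[OF bounded_linear_Re G_lim_has_vector_derivative[OF that, of 0]]
    unfolding Q_G_lim_0 G_lim_0 has_real_derivative_iff_has_vector_derivative by simp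
  show "0 \<le> p_regular s \<and> p_regular s \<le> 1" for s
    by (simp add: p_regular_def)
qed (simp_all add: offspring_gf_continuous offspring_gf_convex offspring_gf_1 p_regular_antimono)

lemma G_lim_eq_integral:
  assumes "p_regular t = 1"
  shows "G_lim t \<xi> = (CLINT X|T. iexp (\<xi> * W_of t X))"
proof -
  have [measurable]: "W_of t \<in> borel_measurable T"
    using measurable_compose[OF _ measurable_W_of, of "\<lambda>X. (t, X)" T] by simp
  have "AE X in T. \<exists>n. confined n t X"
    using assms by (subst T.prob_Collect_eq_1[symmetric]) (auto simp: p_regular_def)
  then show ?thesis
    unfolding G_lim_def by (intro integral_cong_AE) (auto simp: Z_lim_def)
qed

section \<open>Uniqueness\<close>

text \<open>
  Any solution \<open>\<phi>\<close> can differ from \<open>G n\<close> only through realizations that have entered generation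
  \<open>n\<close>. Analytically, \<open>\<phi>\<close> satisfies the integral equation whose iterates are the \<open>G n\<close>, and
  \<open>1 - p_confined n\<close> satisfies the recursion that the estimate for products of nearby factors
  produces for a bound on the difference.
\<close>

lemma difference_le_unconfined:
  fixes \<phi> :: "real \<Rightarrow> real \<Rightarrow> complex"
  assumes char: "\<And>t. 0 \<le> t \<Longrightarrow> \<phi> t \<in> borel_measurable borel \<and> (\<forall>\<xi>. norm (\<phi> t \<xi>) \<le> 1)"
    and C1: "\<And>\<xi>. C1_on_halfline (\<lambda>t. \<phi> t \<xi>)"
    and solves: "solves_cauchy_problem \<kappa> fst (\<lambda>v. fst (snd v)) (\<lambda>v. snd (snd v)) (char \<nu>) \<phi>"
    and t: "0 \<le> t"
  shows "norm (\<phi> t \<xi> - G n t \<xi>) \<le> 1 - p_confined n t"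
  using t
proof (induction n arbitrary: t \<xi>)
  case 0
  then have "p_confined 0 t = 0" by (simp add: p_confined_def not_confined_0)
  moreover have "G 0 t \<xi> = 0" using 0 by (simp add: G_def Z_def not_confined_0)
  ultimately show ?case using char 0 by simp
next
  case (Suc n)
  have deriv: "((\<lambda>s. \<phi> s \<xi>) has_vector_derivative Q (\<phi> s) \<xi> - \<phi> s \<xi>) (at s within {0..})" if "0 \<le> s" for s
    using solves that by (auto simp: solves_cauchy_problem_def)
  \<comment> \<open>\<open>Q (\<phi> s) \<xi>\<close> is the derivative plus \<open>\<phi> s \<xi>\<close>, hence continuous because \<open>\<phi>\<close> is C1 in time.\<close>
  have q_cont: "continuous_on {0..} (\<lambda>s. Q (\<phi> s) \<xi>)"
  proof -
    obtain f' where f': "\<And>s. 0 \<le> s \<Longrightarrow> ((\<lambda>s. \<phi> s \<xi>) has_vector_derivative f' s) (at s within {0..})"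
      "continuous_on {0..} f'"
      using C1[of \<xi>] unfolding C1_on_halfline_def by blast
    have "at_right s \<le> at s within {0..}" if "0 \<le> s" for s :: real
      by (rule at_le) (use that in auto)
    then have "at s within {0..} \<noteq> bot" if "0 \<le> s" for s :: real
      using that trivial_limit_at_right_real[of s] by (metis bot_unique)
    then have eq: "Q (\<phi> s) \<xi> = f' s + \<phi> s \<xi>" if "0 \<le> s" for s
      using vector_derivative_unique_within[OF _ f'(1) deriv] that by (simp add: algebra_simps)
    have "continuous_on {0..} (\<lambda>s. \<phi> s \<xi>)"
      unfolding continuous_on_eq_continuous_within by (auto intro: has_vector_derivative_continuous f'(1))
    then have "continuous_on {0..} (\<lambda>s. f' s + \<phi> s \<xi>)"
      using f'(2) by (rule continuous_on_add[rotated])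
    then show ?thesis by (rule continuous_on_eq) (simp add: eq)
  qed
  have q_int: "set_integrable lborel {0..t} (\<lambda>u. exp u *\<^sub>R Q (\<phi> u) \<xi>)"
    by (intro borel_integrable_atLeastAtMost' continuous_intros continuous_on_subset[OF q_cont]) auto
  have G_int: "set_integrable lborel {0..t} (\<lambda>u. exp u *\<^sub>R Q (G n u) \<xi>)"
    by (rule set_integrable_exp_bounded) (auto intro: norm_Q_le_1 norm_G_le_1)
  have exp_int: "set_integrable lborel {0..t} (\<lambda>u. exp u :: real)"
    by (intro borel_integrable_atLeastAtMost' continuous_intros)
  have gf_meas: "(\<lambda>u. offspring_gf (p_confined n u)) \<in> borel_measurable borel"
    using measurable_compose[OF Q_G_measurable[of n 0] borel_measurable_Re] by (simp add: Q_G_0)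
  have gf_bounds: "offspring_gf (p_confined n u) \<in> {0..1}" for u
    using offspring_gf_bounds[of "p_confined n u"] p_confined_bounds by auto
  have gf_int: "set_integrable lborel {0..t} (\<lambda>u. exp u * offspring_gf (p_confined n u))"
    unfolding set_integrable_def
  proof (rule Bochner_Integration.integrable_bound[OF exp_int[unfolded set_integrable_def]])
    show "AE x in lborel. norm (indicator {0..t} x *\<^sub>R (exp x * offspring_gf (p_confined n x)))
        \<le> norm (indicator {0..t} x *\<^sub>R exp x)"
      using gf_bounds by (auto simp: indicator_def mult_left_le abs_mult)
  qed (use gf_meas in measurable)
  have gap: "norm (Q (\<phi> u) \<xi> - Q (G n u) \<xi>) \<le> 1 - offspring_gf (p_confined n u)" if "0 \<le> u" for u
  proof -
    let ?f = "\<lambda>\<psi> v :: nat \<times> real \<times> (nat \<Rightarrow> real). iexp (\<xi> * fst (snd v)) * (\<Prod>k<fst v. \<psi> (snd (snd v) k * \<xi>)) :: complex"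
    have int: "integrable \<kappa> (?f (\<phi> u))" "integrable \<kappa> (?f (G n u))"
      by (rule Q_integrable; use char[OF that] norm_G_le_1 in simp)+
    have "norm (Q (\<phi> u) \<xi> - Q (G n u) \<xi>) = norm (CLINT v|\<kappa>. ?f (\<phi> u) v - ?f (G n u) v)"
      unfolding Q_hat_def using int by simp
    also have "\<dots> \<le> (LINT v|\<kappa>. norm (?f (\<phi> u) v - ?f (G n u) v))"
      by (rule integral_norm_bound)
    also have "\<dots> \<le> (LINT v|\<kappa>. 1 - p_confined n u ^ fst v)"
    proof (rule integral_mono)
      fix v :: "nat \<times> real \<times> (nat \<Rightarrow> real)"
      have "norm (?f (\<phi> u) v - ?f (G n u) v) =
          norm ((\<Prod>k<fst v. \<phi> u (snd (snd v) k * \<xi>)) - (\<Prod>k<fst v. G n u (snd (snd v) k * \<xi>)))"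
        by (simp only: right_diff_distrib[symmetric] norm_mult norm_exp_i_times mult_1_left)
      also have "\<dots> \<le> 1 - p_confined n u ^ fst v"
        using char[OF that]
        by (intro norm_prod_diff_le_1_minus_power norm_G_le_p_confined Suc.IH[OF that]) blast
      finally show "norm (?f (\<phi> u) v - ?f (G n u) v) \<le> 1 - p_confined n u ^ fst v" .
    next
      show "integrable \<kappa> (\<lambda>v. norm (?f (\<phi> u) v - ?f (G n u) v))"
        by (intro integrable_norm Bochner_Integration.integrable_diff int)
      show "integrable \<kappa> (\<lambda>v. 1 - p_confined n u ^ fst v)"
        using p_confined_bounds
        by (intro Bochner_Integration.integrable_diff power_offspring_integrable kappa.integrable_const) auto
    qed
    also have "\<dots> = 1 - offspring_gf (p_confined n u)"
    proof -
      have "integrable \<kappa> (\<lambda>v. p_confined n u ^ fst v)"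
        by (rule power_offspring_integrable) (use p_confined_bounds in simp)
      then show ?thesis
        by (simp add: offspring_gf_def kappa.prob_space)
    qed
    finally show ?thesis .
  qed
  have p_Suc: "p_confined (Suc n) t = exp (-t) * (1 + (LBINT u:{0..t}. exp u * offspring_gf (p_confined n u)))"
  proof -
    have "(LBINT u:{0..t}. exp u *\<^sub>R Q (G n u) 0) = of_real (LBINT u:{0..t}. exp u * offspring_gf (p_confined n u))"
      unfolding set_integral_complex_of_real[symmetric] Q_G_0 by (simp add: scaleR_conv_of_real)
    then have "of_real (p_confined (Suc n) t) =
        (of_real (exp (-t) * (1 + (LBINT u:{0..t}. exp u * offspring_gf (p_confined n u)))) :: complex)"
      using G_Suc[OF Suc.prems, of n 0] by (simp add: G_0 nu.char_zero scaleR_conv_of_real)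
    then show ?thesis using of_real_eq_iff by blast
  qed
  have "\<phi> t \<xi> = exp (-t) *\<^sub>R (char \<nu> \<xi> + (LBINT u:{0..t}. exp u *\<^sub>R Q (\<phi> u) \<xi>))"
    using duhamel_formula[OF deriv q_cont Suc.prems] solves by (simp add: solves_cauchy_problem_def)
  then have "\<phi> t \<xi> - G (Suc n) t \<xi> = exp (-t) *\<^sub>R (LBINT u:{0..t}. exp u *\<^sub>R Q (\<phi> u) \<xi> - exp u *\<^sub>R Q (G n u) \<xi>)"
    unfolding G_Suc[OF Suc.prems] by (subst set_integral_diff(2)[OF q_int G_int]) (simp add: algebra_simps)
  then have "norm (\<phi> t \<xi> - G (Suc n) t \<xi>) =
      exp (-t) * norm (LBINT u:{0..t}. exp u *\<^sub>R Q (\<phi> u) \<xi> - exp u *\<^sub>R Q (G n u) \<xi>)"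
    by (simp only: norm_scaleR abs_exp_cancel)
  also have "\<dots> \<le> exp (-t) * (LBINT u:{0..t}. exp u - exp u * offspring_gf (p_confined n u))"
  proof -
    have "norm (LBINT u:{0..t}. exp u *\<^sub>R Q (\<phi> u) \<xi> - exp u *\<^sub>R Q (G n u) \<xi>) \<le>
        (LBINT u:{0..t}. norm (exp u *\<^sub>R Q (\<phi> u) \<xi> - exp u *\<^sub>R Q (G n u) \<xi>))"
      by (rule set_integral_norm_bound[OF set_integral_diff(1)[OF q_int G_int]])
    also have "\<dots> \<le> (LBINT u:{0..t}. exp u - exp u * offspring_gf (p_confined n u))"
    proof (rule set_integral_mono)
      show "set_integrable lborel {0..t} (\<lambda>u. norm (exp u *\<^sub>R Q (\<phi> u) \<xi> - exp u *\<^sub>R Q (G n u) \<xi>))"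
        by (rule set_integrable_norm[OF set_integral_diff(1)[OF q_int G_int]])
      show "norm (exp u *\<^sub>R Q (\<phi> u) \<xi> - exp u *\<^sub>R Q (G n u) \<xi>) \<le> exp u - exp u * offspring_gf (p_confined n u)"
        if "u \<in> {0..t}" for u
        using mult_left_mono[OF gap, of u "exp u"] that
        by (simp add: scaleR_diff_right[symmetric] right_diff_distrib)
    qed (rule set_integral_diff(1)[OF exp_int gf_int])
    finally show ?thesis by simp
  qed
  also have "(LBINT u:{0..t}. exp u - exp u * offspring_gf (p_confined n u)) =
      (exp t - 1) - (LBINT u:{0..t}. exp u * offspring_gf (p_confined n u))"
  proof -
    have "(LBINT u:{0..t}. exp u :: real) = exp t - exp 0"
      unfolding set_lebesgue_integral_def
      by (rule integral_FTC_atLeastAtMost[OF Suc.prems])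
         (auto intro!: has_vector_derivative_real_field derivative_eq_intros continuous_intros
           simp flip: has_real_derivative_iff_has_vector_derivative)
    then show ?thesis by (simp add: set_integral_diff(2)[OF exp_int gf_int])
  qed
  also have "exp (-t) * ((exp t - 1) - (LBINT u:{0..t}. exp u * offspring_gf (p_confined n u))) = 1 - p_confined (Suc n) t"
    unfolding p_Suc by (simp add: algebra_simps exp_minus)
  finally show ?case .
qed

lemma solution_unique:
  assumes "\<And>t. 0 \<le> t \<Longrightarrow> \<phi> t \<in> borel_measurable borel \<and> (\<forall>\<xi>. norm (\<phi> t \<xi>) \<le> 1)"
    and "\<And>\<xi>. C1_on_halfline (\<lambda>t. \<phi> t \<xi>)"
    and "solves_cauchy_problem \<kappa> fst (\<lambda>v. fst (snd v)) (\<lambda>v. snd (snd v)) (char \<nu>) \<phi>"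
    and "0 \<le> t" and regular: "p_regular t = 1"
  shows "\<phi> t \<xi> = G_lim t \<xi>"
proof -
  have "(\<lambda>n. norm (\<phi> t \<xi> - G n t \<xi>)) \<longlonglongrightarrow> norm (\<phi> t \<xi> - G_lim t \<xi>)"
    by (intro tendsto_intros G_tendsto_G_lim)
  moreover have "(\<lambda>n. 1 - p_confined n t) \<longlonglongrightarrow> 1 - p_regular t"
    by (intro tendsto_intros p_confined_tendsto)
  ultimately have "norm (\<phi> t \<xi> - G_lim t \<xi>) \<le> 1 - p_regular t"
    by (rule LIMSEQ_le) (use difference_le_unconfined[OF assms(1-4)] in auto)
  then show ?thesis by (simp add: regular)
qed

end

section \<open>Transfer from the canonical space\<close>

lemma Q_hat_distr:
  assumes vector: "(\<lambda>\<omega>. (N \<omega>, C \<omega>, A \<omega>)) \<in> \<Omega> \<rightarrow>\<^sub>M mark_space"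
    and [measurable]: "\<psi> \<in> borel_measurable borel"
  shows "Q_hat (distr \<Omega> mark_space (\<lambda>\<omega>. (N \<omega>, C \<omega>, A \<omega>)))
      fst (\<lambda>v. fst (snd v)) (\<lambda>v. snd (snd v)) \<psi> \<xi> = Q_hat \<Omega> N C A \<psi> \<xi>"
proof -
  have [measurable]: "(\<lambda>v. \<Prod>k<fst v. \<psi> (snd (snd v) k * \<xi>)) \<in> borel_measurable mark_space"
    by (rule measurable_compose_countable[where g=fst]) measurable
  show ?thesis
    unfolding Q_hat_def by (subst integral_distr[OF vector]) auto
qed

context marked_ctbrw
begin

definition marks :: "'a \<Rightarrow> label \<Rightarrow> mark" where
  "marks \<omega> x = (E x \<omega>, R x \<omega>, N x \<omega>, C x \<omega>, A x \<omega>)"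

lemma W_eq_W_of: "W E R N C A t \<omega> = W_of t (marks \<omega>)"
  by (simp add: W_def W_of_def marks_def)

lemma marks_measurable: "marks \<in> M \<rightarrow>\<^sub>M tree_algebra"
proof (rule measurable_PiM_single')
  show "(\<lambda>\<omega>. marks \<omega> x) \<in> M \<rightarrow>\<^sub>M mark_algebra" for x
    using indep by (simp add: indep_vars_def marks_def)
  then show "marks \<in> space M \<rightarrow> (\<Pi>\<^sub>E i\<in>UNIV. space mark_algebra)"
    by (auto dest: measurable_space)
qed

lemma distr_marks:
  "distr M tree_algebra marks =
    (\<Pi>\<^sub>M x\<in>UNIV. density lborel (exponential_density 1) \<Otimes>\<^sub>M \<nu> \<Otimes>\<^sub>M \<kappa>)"
proof -
  have "distr M tree_algebra (\<lambda>\<omega>. \<lambda>x\<in>UNIV. (E x \<omega>, R x \<omega>, N x \<omega>, C x \<omega>, A x \<omega>)) =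
      (\<Pi>\<^sub>M x\<in>UNIV. distr M mark_algebra (\<lambda>\<omega>. (E x \<omega>, R x \<omega>, N x \<omega>, C x \<omega>, A x \<omega>)))"
    using indep by (intro iffD1[OF indep_vars_iff_distr_eq_PiM]) (auto simp: indep_vars_def)
  then show ?thesis
    unfolding law by (simp add: marks_def[abs_def] restrict_UNIV)
qed

end

theorem theorem2p1:
  fixes \<nu> :: "real measure"
    and \<Omega> :: "'b measure"
    and N :: "'b \<Rightarrow> nat" and C :: "'b \<Rightarrow> real" and A :: "'b \<Rightarrow> nat \<Rightarrow> real"
    and M :: "'a measure"
    and Ev Rv :: "label \<Rightarrow> 'a \<Rightarrow> real" and Nv :: "label \<Rightarrow> 'a \<Rightarrow> nat"
    and Cv :: "label \<Rightarrow> 'a \<Rightarrow> real" and Av :: "label \<Rightarrow> 'a \<Rightarrow> nat \<Rightarrow> real"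
  assumes \<nu>: "real_distribution \<nu>"
    and \<Omega>: "prob_space \<Omega>"
    and vector: "(\<lambda>\<omega>. (N \<omega>, C \<omega>, A \<omega>)) \<in> \<Omega> \<rightarrow>\<^sub>M mark_space"
    and i: "\<forall>\<^sub>F \<epsilon> in at_right (0::real).
      (\<integral>\<^sup>+ s\<in>{1 - \<epsilon>..1}. ennreal (1 / (s - (LINT \<omega>|\<Omega>. s ^ N \<omega>))) \<partial>lborel) = \<infinity>"
    and ii: "\<And>m. \<P>(\<omega> in \<Omega>. N \<omega> = m) > 0 \<Longrightarrow>
      \<P>(\<omega> in \<Omega>. (\<forall>k<m. A \<omega> k > 0) \<bar> N \<omega> = m) = 1"
    and iii: "\<exists>m. \<P>(\<omega> in \<Omega>. N \<omega> = m) > 0 \<and>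
      \<P>(\<omega> in \<Omega>. (\<forall>k<m. A \<omega> k = 1) \<bar> N \<omega> = m) < 1"
    and iv: "(\<integral>\<^sup>+ \<omega>. of_nat (N \<omega>) \<partial>\<Omega>) > 1"
    and brw: "marked_ctbrw M \<nu> (distr \<Omega> mark_space (\<lambda>\<omega>. (N \<omega>, C \<omega>, A \<omega>))) Ev Rv Nv Cv Av"
  defines "\<Phi> \<equiv> (\<lambda>t \<xi>. CLINT \<omega>|M. iexp (\<xi> * W Ev Rv Nv Cv Av t \<omega>))"
  shows "(\<Phi> \<in> solution_class \<and> solves_cauchy_problem \<Omega> N C A (char \<nu>) \<Phi>) \<and>
    (\<forall>\<phi>. \<phi> \<in> solution_class \<and> solves_cauchy_problem \<Omega> N C A (char \<nu>) \<phi> \<longrightarrow>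
       (\<forall>t\<ge>0. \<forall>\<xi>. \<phi> t \<xi> = \<Phi> t \<xi>))"
proof -
  define \<kappa> where "\<kappa> = distr \<Omega> mark_space (\<lambda>\<omega>. (N \<omega>, C \<omega>, A \<omega>))"
  interpret nu: real_distribution \<nu> by fact
  interpret \<Omega>: prob_space \<Omega> by fact
  interpret brw: marked_ctbrw M \<nu> \<kappa> Ev Rv Nv Cv Av using brw by (simp add: \<kappa>_def)
  interpret branching_law \<nu> \<kappa>
  proof -
    interpret kappa: prob_space \<kappa> unfolding \<kappa>_def by (rule \<Omega>.prob_space_distr[OF vector])
    show "branching_law \<nu> \<kappa>" by unfold_locales (simp add: \<kappa>_def)
  qed
  have Q_eq: "Q \<psi> \<xi> = Q_hat \<Omega> N C A \<psi> \<xi>" if "\<psi> \<in> borel_measurable borel" for \<psi> \<xi>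
    unfolding \<kappa>_def by (rule Q_hat_distr[OF vector that])
  have "offspring_gf s = (LINT \<omega>|\<Omega>. s ^ N \<omega>)" for s
  proof -
    have "(LINT v|\<kappa>. s ^ fst v) = (LINT \<omega>|\<Omega>. s ^ N \<omega>)"
      unfolding \<kappa>_def by (subst integral_distr[OF vector]) auto
    then show ?thesis by (simp add: offspring_gf_def)
  qed
  then have regular: "p_regular t = 1" if "0 \<le> t" for t
    using p_regular_eq_1[OF _ that] i by simp
  have W_of_meas [measurable]: "W_of t \<in> borel_measurable tree_algebra" for t
    using measurable_compose[OF _ measurable_W_of, of "\<lambda>X. (t, X)" tree_algebra] by simp
  have T_eq: "T = distr M tree_algebra brw.marks"
    by (simp add: brw.distr_marks T_def P_def)
  have \<Phi>_eq: "\<Phi> t \<xi> = G_lim t \<xi>" if "0 \<le> t" for t \<xi>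
    unfolding G_lim_eq_integral[OF regular[OF that]] T_eq \<Phi>_def brw.W_eq_W_of
    by (rule integral_distr[OF brw.marks_measurable, symmetric]) measurable
  have \<Phi>_char: "\<Phi> t = char (distr M borel (W Ev Rv Nv Cv Av t))" for t
    unfolding \<Phi>_def char_def brw.W_eq_W_of[abs_def]
    by (subst integral_distr[OF measurable_compose[OF brw.marks_measurable W_of_meas]]) auto
  have \<Phi>_deriv: "((\<lambda>s. \<Phi> s \<xi>) has_vector_derivative Q (G_lim t) \<xi> - G_lim t \<xi>) (at t within {0..})"
    if "0 \<le> t" for t \<xi>
    by (rule has_vector_derivative_transform[OF _ _ G_lim_has_vector_derivative[OF that]])
       (use that in \<open>auto simp: \<Phi>_eq\<close>)
  have "\<Phi> \<in> solution_class"
    unfolding solution_class_def mem_Collect_eq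
  proof (intro conjI allI impI)
    show "\<exists>\<mu>. real_distribution \<mu> \<and> \<Phi> t = char \<mu>" for t
      using \<Phi>_char[of t] measurable_compose[OF brw.marks_measurable W_of_meas[of t]]
      by (auto intro!: exI[of _ "distr M borel (W Ev Rv Nv Cv Av t)"] brw.real_distribution_distr
          simp: brw.W_eq_W_of[abs_def])
    show "C1_on_halfline (\<lambda>t. \<Phi> t \<xi>)" for \<xi>
      unfolding C1_on_halfline_def
      using \<Phi>_deriv
      by (auto intro!: exI[of _ "\<lambda>t. Q (G_lim t) \<xi> - G_lim t \<xi>"] continuous_intros
          continuous_on_Q_G_lim continuous_on_G_lim)
  qed
  moreover have "solves_cauchy_problem \<Omega> N C A (char \<nu>) \<Phi>"
    unfolding solves_cauchy_problem_def
  proof (intro conjI allI impI)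
    fix t \<xi> :: real assume "0 \<le> t"
    moreover have "\<Phi> t = G_lim t" using \<Phi>_eq[OF \<open>0 \<le> t\<close>] by (simp add: fun_eq_iff)
    ultimately show "((\<lambda>s. \<Phi> s \<xi>) has_vector_derivative Q_hat \<Omega> N C A (\<Phi> t) \<xi> - \<Phi> t \<xi>) (at t within {0..})"
      using \<Phi>_deriv[of t \<xi>] by (simp add: Q_eq)
  next
    show "\<Phi> 0 \<xi> = char \<nu> \<xi>" for \<xi>
      by (simp add: \<Phi>_eq G_lim_at_0)
  qed
  moreover have "\<phi> t \<xi> = \<Phi> t \<xi>"
    if \<phi>: "\<phi> \<in> solution_class" "solves_cauchy_problem \<Omega> N C A (char \<nu>) \<phi>" and t: "0 \<le> t" for \<phi> t \<xi>
  proof -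
    have char: "\<phi> s \<in> borel_measurable borel \<and> (\<forall>\<xi>. norm (\<phi> s \<xi>) \<le> 1)" if "0 \<le> s" for s
    proof -
      have "\<forall>s\<ge>0. \<exists>\<mu>. real_distribution \<mu> \<and> \<phi> s = char \<mu>"
        using \<phi>(1) unfolding solution_class_def by simp
      from this[rule_format, OF that] obtain \<mu> where \<mu>: "real_distribution \<mu>" "\<phi> s = char \<mu>"
        by (elim exE conjE)
      then show ?thesis
        using real_distribution.char_measurable real_distribution.cmod_char_le_1 by auto
    qed
    have "solves_cauchy_problem \<kappa> fst (\<lambda>v. fst (snd v)) (\<lambda>v. snd (snd v)) (char \<nu>) \<phi>"
      using \<phi>(2) char by (simp add: solves_cauchy_problem_def Q_eq)
    then have "\<phi> t \<xi> = G_lim t \<xi>"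
      using \<phi>(1) by (intro solution_unique char t regular) (auto simp: solution_class_def)
    then show ?thesis by (simp add: \<Phi>_eq t)
  qed
  ultimately show ?thesis by blast
qed

end
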